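(* The following ten identities hold: (1) $\displaystyle 6\int_0^1\frac{x\arctan x\,\ln x}{1+x^2}\,dx+4\int_0^1\frac{\arctan x\,\ln(1+x)}{x}\,dx=-\frac{3\pi^3}{32}+6G\ln 2$; (2) $\displaystyle \int_0^1\frac{x\arctan x\,\ln x}{1+x^2}\,dx+\int_0^1\frac{\arctan x\,\ln(1+x^2)}{x}\,dx=-\frac{\pi^3}{64}+G\ln 2$; (3) $\displaystyle \int_0^1\frac{x\arctan x\,\ln x}{1+x^2}\,dx+2\int_0^1\frac{\arctan x\,\ln(1-x)}{x}\,dx=-\frac{5\pi^3}{64}+G\ln 2$; (4) $\displaystyle 3\int_0^1\frac{\ln x\,\ln(1+x^2)}{1+x^2}\,dx-2\int_0^1\frac{\arctan x\,\ln(1+x)}{x}\,dx=-6G\ln 2+\frac{3\pi^3}{32}$; (5) $\displaystyle \int_0^1\frac{\ln x\,\ln(1+x^2)}{1+x^2}\,dx-\int_0^1\frac{\arctan x\,\ln(1+x^2)}{x}\,dx=-2G\ln 2+\frac{\pi^3}{32}$; (6) $\displaystyle \int_0^1\frac{\ln x\,\ln(1+x^2)}{1+x^2}\,dx-2\int_0^1\frac{\arctan x\,\ln(1-x)}{x}\,dx=-2G\ln 2+\frac{3\pi^3}{32}$; (7) $\displaystyle \int_0^1\frac{\arctan x\,\ln(1+x)}{x}\,dx+3\int_0^1\frac{x\arctan x\,\ln(1+x^2)}{1+x^2}\,dx=3G\ln 2-\frac{\pi^3}{64}-\frac{9\pi}{16}\ln^2 2$; (8) $\displaystyle \int_0^1\frac{\arctan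 x\,\ln(1-x)}{x}\,dx+\int_0^1\frac{x\arctan x\,\ln(1+x^2)}{1+x^2}\,dx=G\ln 2-\frac{7\pi^3}{192}-\frac{3\pi}{16}\ln^2 2$; (9) $\displaystyle \int_0^1\frac{\ln x\,\ln(1+x^2)}{1+x^2}\,dx+\int_0^1\frac{x\arctan x\,\ln x}{1+x^2}\,dx=-G\ln 2+\frac{\pi^3}{64}$; (10) $\displaystyle 2\int_0^1\frac{x\arctan x\,\ln(1+x^2)}{1+x^2}\,dx-\int_0^1\frac{x\arctan x\,\ln x}{1+x^2}\,dx=G\ln 2+\frac{\pi^3}{192}-\frac{3\pi}{8}\ln^2 2$.
   Context: $G=\sum_{k=0}^\infty\frac{(-1)^k}{(2k+1)^2}$ is Catalan's constant. *)

theory Defs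
  imports "HOL-Analysis.Analysis"
begin

definition catalan_constant :: real where
  "catalan_constant = (\<Sum>k. (- 1) ^ k / (2 * real k + 1)\<^sup>2)"

lemma summable_catalan: "summable (\<lambda>k. (- 1) ^ k / (2 * real k + 1)\<^sup>2 :: real)"
proof (rule summable_comparison_test')
  show "summable (\<lambda>k. 1 / (real (Suc k))\<^sup>2)"
    using inverse_squares_sums by (simp add: sums_iff add.commute)
  show "norm ((- 1) ^ k / (2 * real k + 1)\<^sup>2 :: real) \<le> 1 / (real (Suc k))\<^sup>2"
    if "k \<ge> 0" for k
    by (auto simp: abs_mult power_abs intro!: divide_left_mono power_mono)
qed

end

theory Submission
  imports Defs "HOL-Real_Asymp.Real_Asymp" "HOL-Complex_Analysis.Complex_Analysis"
begin

text \<open>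
  Write \<open>A, B, C, D, E, F\<close> for the six integrals in the order of the statement and \<open>G\<close> for
  Catalan's constant. Five linear relations imply the ten identities.
  Integrating the derivative of \<open>arctan x ln x ln (1 + x\<^sup>2)\<close> gives \<open>E + C + 2 A = 0\<close>.
  With \<open>k y = \<integral> x\<^sup>2 ln x / ((1 + x\<^sup>2) (1 + x\<^sup>2 y\<^sup>2)) dx\<close>, Fubini gives
  \<open>A = \<integral> k y dy\<close> and \<open>E = \<integral> 2 y k y dy\<close>, while partial fractions express \<open>k\<close> by the
  inverse tangent integral; integration by parts then yields \<open>E = B - D - 2 G ln 2\<close> and
  \<open>A = - (B + D) / 2 + G ln 2 - \<pi>\<^sup>3 / 32\<close>.
  Put \<open>Z = \<integral> ln\<^sup>2 (1 + x\<^sup>2) / (1 + x\<^sup>2) dx = \<pi> / 4 ln\<^sup>2 2 - 4 F\<close> (by parts).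
  The duplication \<open>sin 2t = 2 sin t cos t\<close> with \<open>x = tan t\<close> evaluates \<open>E - Z / 2\<close>, and
  Cauchy's theorem for \<open>Ln\<^sup>2 (1 + z) / z\<close> on a quarter disc evaluates \<open>C - Z / 2\<close>.
\<close>

section \<open>Inverse tangent integrals\<close>

text \<open>The inverse tangent integral of order \<open>n\<close>, that is, the imaginary part of
  the polylogarithm of order \<open>n\<close> at \<open>\<i> x\<close>. Order 1 is arctan; the
  values at 1 are those of the Dirichlet beta function.\<close>

definition Ti :: "nat \<Rightarrow> real \<Rightarrow> real" where
  "Ti n x = (\<Sum>k. (- 1) ^ k * x ^ (2 * k + 1) / (2 * real k + 1) ^ n)"

lemma summable_Ti:
  assumes "\<bar>x\<bar> < 1"
  shows "summable (\<lambda>k. (- 1) ^ k * x ^ (2 * k + 1) / (2 * real k + 1) ^ n)"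
proof (rule summable_comparison_test')
  have "x\<^sup>2 < 1" using assms by (simp add: abs_square_less_1)
  then show "summable (\<lambda>k. (x\<^sup>2) ^ k)" by (intro summable_geometric) auto
  show "norm ((- 1) ^ k * x ^ (2 * k + 1) / (2 * real k + 1) ^ n) \<le> (x\<^sup>2) ^ k" if "k \<ge> 0" for k
  proof -
    have "\<bar>x\<bar> ^ (2 * k + 1) / (2 * real k + 1) ^ n \<le> \<bar>x\<bar> ^ (2 * k + 1) / 1"
      by (intro divide_left_mono) auto
    also have "\<dots> \<le> \<bar>x\<bar> ^ (2 * k)"
      using assms by (simp add: mult_left_le_one_le)
    also have "\<dots> = (x\<^sup>2) ^ k" by (simp add: power_mult)
    finally show ?thesis by (simp add: abs_mult power_abs)
  qed
qed

text \<open>Termwise differentiation cancels one factor \<open>2 * k + 1\<close> of the denominator;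
  the division by \<open>x\<close> accounts for the power lowered by one.\<close>

lemma has_field_derivative_Ti:
  assumes "\<bar>x\<bar> < 1" "x \<noteq> 0"
  shows "(Ti (Suc n) has_field_derivative Ti n x / x) (at x)"
proof -
  \<comment> \<open>The midpoint between \<open>\<bar>x\<bar>\<close> and 1: \<open>x\<close> is
    interior to \<open>{-r..r}\<close>, where the derivatives are dominated by a geometric series of
    ratio \<open>r\<^sup>2 < 1\<close>.\<close>
  define r where "r = (1 + \<bar>x\<bar>) / 2"
  have r: "\<bar>x\<bar> < r" "r < 1" "r > 0" using assms by (auto simp: r_def)
  define f where "f = (\<lambda>k x. (- 1) ^ k * x ^ (2 * k + 1) / (2 * real k + 1) ^ Suc n)"
  define f' where "f' = (\<lambda>k x. (- 1) ^ k * x ^ (2 * k) / (2 * real k + 1) ^ n)"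
  have "((\<lambda>x. \<Sum>k. f k x) has_field_derivative (\<Sum>k. f' k x)) (at x)"
  proof (rule has_field_derivative_series'(2))
    show "convex {-r..r}" by simp
    show "(f k has_field_derivative f' k x) (at x within {-r..r})" for k x
    proof -
      have "((\<lambda>x. x ^ (2 * k + 1)) has_field_derivative (2 * real k + 1) * x ^ (2 * k)) (at x within {-r..r})"
        using DERIV_pow [of "2 * k + 1"] by (simp add: add.commute)
      then have "(f k has_field_derivative (- 1) ^ k * ((2 * real k + 1) * x ^ (2 * k)) / (2 * real k + 1) ^ Suc n) (at x within {-r..r})"
        unfolding f_def by (intro DERIV_cdivide DERIV_cmult)
      moreover have "2 * real k + 1 \<noteq> 0" by simp
      ultimately show ?thesis unfolding f'_def
        by (smt (verit) mult_divide_mult_cancel_left mult.left_commute power_Suc)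
    qed
    show "uniformly_convergent_on {-r..r} (\<lambda>m x. \<Sum>i<m. f' i x)"
    proof (rule Weierstrass_m_test')
      show "summable (\<lambda>k. (r\<^sup>2) ^ k)" using r by (intro summable_geometric) (auto simp: abs_square_less_1)
      show "norm (f' k y) \<le> (r\<^sup>2) ^ k" if "y \<in> {-r..r}" for k y
      proof -
        have "\<bar>y\<bar> ^ (2 * k) / (2 * real k + 1) ^ n \<le> \<bar>y\<bar> ^ (2 * k) / 1"
          by (intro divide_left_mono) auto
        also have "\<dots> \<le> r ^ (2 * k)" using that by (auto intro!: power_mono)
        finally show ?thesis by (simp add: f'_def abs_mult power_abs power_mult)
      qed
    qed
    show "summable (\<lambda>k. f k 0)" by (simp add: f_def)
  qed (use r in \<open>auto simp: abs_less_iff\<close>)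
  moreover have "(\<Sum>k. f' k x) = Ti n x / x"
  proof -
    have "Ti n x / x = (\<Sum>k. (- 1) ^ k * x ^ (2 * k + 1) / (2 * real k + 1) ^ n / x)"
      unfolding Ti_def by (rule suminf_divide [symmetric]) (use summable_Ti assms in auto)
    then show ?thesis using assms by (simp add: f'_def)
  qed
  ultimately show ?thesis unfolding Ti_def [abs_def] f_def by simp
qed

lemma Ti_1: "\<bar>x\<bar> \<le> 1 \<Longrightarrow> Ti (Suc 0) x = arctan x"
  by (simp add: Ti_def arctan_series mult.commute add.commute)

text \<open>From order 2 on, the terms are dominated by \<open>1 / (k + 1)^2\<close> on the closed
  interval, so the Weierstrass test includes the endpoint 1, where boundary values are taken
  later.\<close>

lemma continuous_on_Ti:
  assumes "n \<ge> 2"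
  shows "continuous_on {0..1} (Ti n)"
proof -
  define f where "f = (\<lambda>k x. (- 1) ^ k * x ^ (2 * k + 1) / (2 * real k + 1) ^ n)"
  have "uniform_limit {0..1} (\<lambda>m x. \<Sum>k<m. f k x) (\<lambda>x. \<Sum>k. f k x) sequentially"
  proof (rule Weierstrass_m_test)
    show "summable (\<lambda>k. 1 / (real (Suc k))\<^sup>2)"
      using inverse_squares_sums by (simp add: sums_iff add.commute)
    show "norm (f k x) \<le> 1 / (real (Suc k))\<^sup>2" if "x \<in> {0..1}" for k x
    proof -
      have "norm (f k x) = x ^ (2 * k + 1) / (2 * real k + 1) ^ n"
        using that by (simp add: f_def abs_mult power_abs)
      also have "\<dots> \<le> 1 / (2 * real k + 1) ^ n"
        using that by (intro divide_right_mono power_le_one) auto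
      also have "\<dots> \<le> 1 / (2 * real k + 1) ^ 2"
        using assms by (intro divide_left_mono power_increasing) auto
      also have "\<dots> \<le> 1 / (real (Suc k))\<^sup>2"
        by (intro divide_left_mono power_mono) auto
      finally show ?thesis .
    qed
  qed
  then have "continuous_on {0..1} (\<lambda>x. \<Sum>k. f k x)"
    by (rule uniform_limit_theorem [rotated]) (auto simp: f_def intro!: always_eventually continuous_intros)
  then show ?thesis by (simp add: Ti_def [abs_def] f_def)
qed

lemma Ti_0 [simp]: "Ti n 0 = 0"
  by (simp add: Ti_def)

lemma Ti_2_1: "Ti 2 1 = catalan_constant"
  by (simp add: Ti_def catalan_constant_def)

section \<open>Polygamma reflection formulas and the value of \<open>Ti 3\<close> at 1\<close>

lemma ln_Gamma_reflection:
  fixes x :: real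
  assumes "0 < x" "x < 1"
  shows "ln_Gamma x + ln_Gamma (1 - x) = ln pi - ln (sin (pi * x))"
proof -
  have s: "sin (pi * x) > 0" using assms by (intro sin_gt_zero) auto
  \<comment> \<open>Euler's complex reflection formula at a real argument; injectivity of
    \<open>of_real\<close> brings it down to the reals.\<close>
  have "complex_of_real (Gamma x * Gamma (1 - x)) = of_real (pi / sin (pi * x))"
    using Gamma_reflection_complex [of "of_real x"]
    by (metis Gamma_complex_of_real of_real_1 of_real_diff of_real_divide of_real_mult sin_of_real)
  then have "Gamma x * Gamma (1 - x) = pi / sin (pi * x)"
    using of_real_eq_iff by blast
  then have "ln (Gamma x * Gamma (1 - x)) = ln (pi / sin (pi * x))" by simp
  then show ?thesis
    using assms s by (simp add: ln_mult ln_div ln_Gamma_real_pos Gamma_real_pos less_imp_neq[symmetric])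
qed

text \<open>The two sides are derivatives of the two sides of the logarithmic reflection formula,
  which agree on the open unit interval. The next two lemmas differentiate again, up to the order
  that matches cubic reciprocals.\<close>

lemma Digamma_reflection:
  fixes x :: real
  assumes "0 < x" "x < 1"
  shows "Polygamma 0 x - Polygamma 0 (1 - x) = - pi * cot (pi * x)"
proof (rule DERIV_unique)
  have s: "sin (pi * x) > 0" using assms by (intro sin_gt_zero) auto
  show "((\<lambda>x. ln_Gamma x + ln_Gamma (1 - x)) has_field_derivative Polygamma 0 x - Polygamma 0 (1 - x)) (at x)"
    using assms by (auto intro!: derivative_eq_intros)
  have "((\<lambda>x. ln pi - ln (sin (pi * x))) has_field_derivative - pi * cot (pi * x)) (at x)"
    using assms s by (auto intro!: derivative_eq_intros simp: cot_def)
  then show "((\<lambda>x. ln_Gamma x + ln_Gamma (1 - x)) has_field_derivative - pi * cot (pi * x)) (at x)"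
    by (rule has_field_derivative_transform_within_open [where S = "{0<..<1}"])
       (use assms ln_Gamma_reflection in auto)
qed

lemma Trigamma_reflection:
  fixes x :: real
  assumes "0 < x" "x < 1"
  shows "Polygamma 1 x + Polygamma 1 (1 - x) = pi\<^sup>2 / (sin (pi * x))\<^sup>2"
proof (rule DERIV_unique)
  have s: "sin (pi * x) > 0" using assms by (intro sin_gt_zero) auto
  have "x \<notin> \<int>\<^sub>\<le>\<^sub>0" "1 - x \<notin> \<int>\<^sub>\<le>\<^sub>0" using assms by (auto elim!: nonpos_Ints_cases)
  then show "((\<lambda>x. Polygamma 0 x - Polygamma 0 (1 - x)) has_field_derivative Polygamma 1 x + Polygamma 1 (1 - x)) (at x)"
    by (auto intro!: derivative_eq_intros)
  have "((\<lambda>x. - pi * cot (pi * x)) has_field_derivative pi\<^sup>2 / (sin (pi * x))\<^sup>2) (at x)"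
    using assms s by (auto intro!: derivative_eq_intros DERIV_cot [THEN DERIV_chain2] simp: divide_simps power2_eq_square)
  then show "((\<lambda>x. Polygamma 0 x - Polygamma 0 (1 - x)) has_field_derivative pi\<^sup>2 / (sin (pi * x))\<^sup>2) (at x)"
    by (rule has_field_derivative_transform_within_open [where S = "{0<..<1}"])
       (use assms Digamma_reflection in auto)
qed

lemma Tetragamma_reflection:
  fixes x :: real
  assumes "0 < x" "x < 1"
  shows "Polygamma 2 x - Polygamma 2 (1 - x) = - 2 * pi ^ 3 * cos (pi * x) / sin (pi * x) ^ 3"
proof (rule DERIV_unique)
  have s: "sin (pi * x) > 0" using assms by (intro sin_gt_zero) auto
  have "x \<notin> \<int>\<^sub>\<le>\<^sub>0" "1 - x \<notin> \<int>\<^sub>\<le>\<^sub>0" using assms by (auto elim!: nonpos_Ints_cases)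
  then show "((\<lambda>x. Polygamma 1 x + Polygamma 1 (1 - x)) has_field_derivative Polygamma 2 x - Polygamma 2 (1 - x)) (at x)"
    by (auto intro!: derivative_eq_intros simp: numeral_2_eq_2)
  have "((\<lambda>x. pi\<^sup>2 / (sin (pi * x))\<^sup>2) has_field_derivative - 2 * pi ^ 3 * cos (pi * x) / sin (pi * x) ^ 3) (at x)"
    using assms s by (auto intro!: derivative_eq_intros simp: divide_simps power2_eq_square power3_eq_cube)
  then show "((\<lambda>x. Polygamma 1 x + Polygamma 1 (1 - x)) has_field_derivative - 2 * pi ^ 3 * cos (pi * x) / sin (pi * x) ^ 3) (at x)"
    by (rule has_field_derivative_transform_within_open [where S = "{0<..<1}"])
       (use assms Trigamma_reflection in auto)
qed

text \<open>Pairing consecutive terms turns the alternating series into the sum of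
  \<open>1 / (4 k + 1)^3 - 1 / (4 k + 3)^3\<close>, a difference of tetragamma values at 1/4 and
  3/4, which reflection evaluates.\<close>

lemma Ti_3_1: "Ti 3 1 = pi ^ 3 / 32"
proof -
  have P: "(\<lambda>k. 1 / (x + real k) ^ 3) sums (- Polygamma 2 x / 2)" if "x > 0" for x :: real
    using Polygamma_LIMSEQ [of x 2] that by (simp add: eval_nat_numeral divide_simps)
  \<comment> \<open>The divisor is \<open>64 = 4 ^ 3\<close>, from
    \<open>4 k + 1 = 4 (1/4 + k)\<close> and \<open>4 k + 3 = 4 (3/4 + k)\<close>.\<close>
  have "(\<lambda>k. (1 / (1/4 + real k) ^ 3 - 1 / (3/4 + real k) ^ 3) / 64) sums
          ((- Polygamma 2 (1/4) / 2 - - Polygamma 2 (3/4) / 2) / 64)"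
    by (intro sums_divide sums_diff P) auto
  moreover have "Polygamma 2 (1/4 :: real) - Polygamma 2 (3/4) = - 4 * pi ^ 3"
  proof -
    have "cos (pi / 4) / sin (pi / 4) ^ 3 = 2"
      by (simp add: sin_45 cos_45 field_simps power3_eq_cube)
    then have "- (2 * pi ^ 3) * (cos (pi * (1/4)) / sin (pi * (1/4)) ^ 3) = - 4 * pi ^ 3" by simp
    then show ?thesis
      using Tetragamma_reflection [of "1/4"] by simp
  qed
  then have "(- Polygamma 2 (1/4) / 2 - - Polygamma 2 (3/4 :: real) / 2) / 64 = pi ^ 3 / 32" by simp
  ultimately have 1: "(\<lambda>k. (1 / (1/4 + real k) ^ 3 - 1 / (3/4 + real k) ^ 3) / 64) sums (pi ^ 3 / 32)"
    by metis
  define f :: "nat \<Rightarrow> real" where "f = (\<lambda>k. (- 1) ^ k / (2 * real k + 1) ^ 3)"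
  have "summable f"
  proof (rule summable_comparison_test')
    show "summable (\<lambda>k. 1 / (real (Suc k))\<^sup>2)"
      using inverse_squares_sums by (simp add: sums_iff add.commute)
    show "norm (f k) \<le> 1 / (real (Suc k))\<^sup>2" if "k \<ge> 0" for k
    proof -
      have "norm (f k) \<le> 1 / (2 * real k + 1) ^ 2"
        by (auto simp: f_def abs_mult power_abs intro!: divide_left_mono power_increasing)
      also have "\<dots> \<le> 1 / (real (Suc k))\<^sup>2"
        by (intro divide_left_mono power_mono) auto
      finally show ?thesis .
    qed
  qed
  then have "f sums Ti 3 1" by (auto simp: sums_iff Ti_def f_def)
  then have "(\<lambda>k. sum f {k * 2..<k * 2 + 2}) sums Ti 3 1" by (rule sums_group) auto
  also have "(\<lambda>k. sum f {k * 2..<k * 2 + 2}) = (\<lambda>k. (1 / (1/4 + real k) ^ 3 - 1 / (3/4 + real k) ^ 3) / 64)"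
  proof
    fix k
    have e: "1/4 + real k = (4 * real k + 1) / 4" "3/4 + real k = (4 * real k + 3) / 4" by auto
    have "{k * 2..<k * 2 + 2} = {k * 2, k * 2 + 1}" by auto
    then have "sum f {k * 2..<k * 2 + 2} = 1 / (4 * real k + 1) ^ 3 - 1 / (4 * real k + 3) ^ 3"
      by (simp add: f_def algebra_simps)
    then show "sum f {k * 2..<k * 2 + 2} = (1 / (1/4 + real k) ^ 3 - 1 / (3/4 + real k) ^ 3) / 64"
      unfolding e by (simp add: power_divide diff_divide_distrib)
  qed
  finally show ?thesis using 1 by (rule sums_unique2)
qed

section \<open>Integrals over the unit interval with logarithmic singularities\<close>

text \<open>Isolates the delicate endpoint of functions such as \<open>x * ln x\<close>: their value
  at 0 comes from the conventions \<open>ln 0 = 0\<close> and \<open>a / 0 = 0\<close> and has to be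
  compared with the one-sided limit.\<close>

lemma continuous_on_unit_intervalI:
  fixes f :: "real \<Rightarrow> real"
  assumes "(f \<longlongrightarrow> f 0) (at_right 0)" "continuous_on {0<..1} f"
  shows "continuous_on {0..1} f"
proof (rule continuous_on_IccI)
  show "(f \<longlongrightarrow> f 1) (at_left 1)"
    by (rule continuous_on_Icc_at_leftD [of "1/2"])
       (auto intro: continuous_on_subset [OF assms(2)])
  have "continuous_on {0<..<1} f"
    using assms(2) by (rule continuous_on_subset) auto
  then show "f \<midarrow>x\<rightarrow> f x" if "0 < x" "x < 1" for x
    using that by (simp add: continuous_on_eq_continuous_at isCont_def)
qed (use assms in auto)

text \<open>Differentiability is asked for only in the interior, so that antiderivatives may contain
  \<open>ln x\<close> or \<open>ln (1 - x)\<close>; continuity takes care of the endpoints.\<close>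

lemma has_integral_FTC_unit:
  fixes f F :: "real \<Rightarrow> real"
  assumes "continuous_on {0..1} F"
    and "\<And>x. 0 < x \<Longrightarrow> x < 1 \<Longrightarrow> (F has_real_derivative f x) (at x)"
  shows "(f has_integral F 1 - F 0) {0..1}"
  using assms
  by (intro fundamental_theorem_of_calculus_interior) (auto simp: has_real_derivative_iff_has_vector_derivative)

lemma has_field_derivative_Ti_2:
  "0 < x \<Longrightarrow> x < 1 \<Longrightarrow> (Ti 2 has_field_derivative arctan x / x) (at x)"
  using has_field_derivative_Ti [of x 1] by (simp add: Ti_1 numeral_2_eq_2)

text \<open>Mean value theorem: the derivative \<open>arctan x / x\<close> lies between 0 and 1.
  This Lipschitz bound lets differences of \<open>Ti 2\<close> absorb a logarithm at either
  endpoint.\<close>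

lemma Ti_2_diff_bounds:
  assumes "0 \<le> a" "a \<le> b" "b \<le> 1"
  shows "0 \<le> Ti 2 b - Ti 2 a" "Ti 2 b - Ti 2 a \<le> b - a"
proof -
  have "0 \<le> Ti 2 b - Ti 2 a \<and> Ti 2 b - Ti 2 a \<le> b - a"
  proof (cases "a = b")
    case False
    have "continuous_on {a..b} (Ti 2)"
      by (rule continuous_on_subset [OF continuous_on_Ti]) (use assms in auto)
    then obtain x where x: "a < x" "x < b" "Ti 2 b - Ti 2 a = arctan x / x * (b - a)"
      using mvt [of a b "Ti 2" "\<lambda>x. (*) (arctan x / x)"] has_field_derivative_Ti_2 False assms
      by (auto simp: has_field_derivative_def)
    moreover have "0 \<le> arctan x / x" "arctan x / x \<le> 1"
      using x assms arctan_le_self [of x] by (auto simp: divide_le_eq)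
    ultimately have "0 \<le> arctan x / x * (b - a)" "arctan x / x * (b - a) \<le> b - a"
      using assms by (intro mult_nonneg_nonneg mult_left_le_one_le; simp)+
    then show ?thesis using x by simp
  qed simp
  then show "0 \<le> Ti 2 b - Ti 2 a" "Ti 2 b - Ti 2 a \<le> b - a" by auto
qed

lemma has_field_derivative_Ti_3:
  "0 < x \<Longrightarrow> x < 1 \<Longrightarrow> (Ti 3 has_field_derivative Ti 2 x / x) (at x)"
  using has_field_derivative_Ti [of x 2] by (simp add: eval_nat_numeral)

lemma tendsto_ln_mult_Ti_2:
  assumes "0 < y" "y \<le> 1"
  shows "((\<lambda>x. ln x * Ti 2 (x * y)) \<longlongrightarrow> 0) (at_right 0)"
proof (rule Lim_null_comparison)
  show "((\<lambda>x::real. x * \<bar>ln x\<bar>) \<longlongrightarrow> 0) (at_right 0)" by real_asymp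
  show "\<forall>\<^sub>F x in at_right 0. norm (ln x * Ti 2 (x * y)) \<le> x * \<bar>ln x\<bar>"
  proof (rule eventually_mono [OF eventually_at_right_real [of 0 1]])
    fix x :: real assume elim: "x \<in> {0<..<1}"
    have "0 \<le> x * y" "x * y \<le> x" "x \<le> 1" using elim assms by (auto intro: mult_left_le)
    then have "\<bar>Ti 2 (x * y)\<bar> \<le> x"
      using Ti_2_diff_bounds [of 0 "x * y"] unfolding Ti_0 by linarith
    then have "\<bar>ln x\<bar> * \<bar>Ti 2 (x * y)\<bar> \<le> \<bar>ln x\<bar> * x" by (intro mult_left_mono) auto
    then show "norm (ln x * Ti 2 (x * y)) \<le> x * \<bar>ln x\<bar>" by (simp add: abs_mult mult.commute)
  qed simp
qed

text \<open>Integration by parts: \<open>arctan (x * y) / y\<close> is a primitive of the rational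
  factor, and the remaining \<open>arctan (x * y) / (x * y)\<close> integrates to
  \<open>Ti 2\<close>. At 1 the logarithm vanishes, so only the \<open>Ti 2\<close> term
  survives.\<close>

lemma has_integral_ln_div:
  assumes "0 < y" "y \<le> 1"
  shows "((\<lambda>x. ln x / (1 + x\<^sup>2 * y\<^sup>2)) has_integral - (Ti 2 y / y)) {0..1}"
proof -
  define F where "F = (\<lambda>x. ln x * arctan (x * y) / y - Ti 2 (x * y) / y)"
  have "((\<lambda>x. ln x / (1 + x\<^sup>2 * y\<^sup>2)) has_integral F 1 - F 0) {0..1}"
  proof (rule has_integral_FTC_unit)
    have cT: "continuous_on {0..1} (\<lambda>x. Ti 2 (x * y))"
      by (rule continuous_on_compose2 [OF continuous_on_Ti [of 2]])
         (use assms in \<open>auto intro!: continuous_intros mult_le_one\<close>)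
    have "continuous_on {0..1} (\<lambda>x. ln x * arctan (x * y) / y)"
    proof (rule continuous_on_unit_intervalI)
      show "((\<lambda>x. ln x * arctan (x * y) / y) \<longlongrightarrow> ln 0 * arctan (0 * y) / y) (at_right 0)"
        using assms by simp real_asymp
    qed (use assms in \<open>auto intro!: continuous_intros\<close>)
    then show "continuous_on {0..1} F"
      unfolding F_def using assms by (intro continuous_on_diff continuous_on_divide [OF cT] continuous_on_const) auto
    fix x :: real assume x: "0 < x" "x < 1"
    then have xy: "0 < x * y" "x * y < 1"
      using assms by (auto intro: le_less_trans [OF mult_left_le])
    have "((\<lambda>x. Ti 2 (x * y)) has_field_derivative arctan (x * y) / (x * y) * y) (at x)"
      by (rule DERIV_chain2 [where f = "Ti 2" and g = "\<lambda>x. x * y", OF has_field_derivative_Ti_2 [OF xy]]) (auto intro!: derivative_eq_intros)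
    then have "((\<lambda>x. Ti 2 (x * y)) has_field_derivative arctan (x * y) / x) (at x)"
      using assms by simp
    then have "(F has_real_derivative (1 / x * arctan (x * y) + ln x * (y / (1 + (x * y)\<^sup>2))) / y - arctan (x * y) / x / y) (at x)"
      unfolding F_def using x assms by (auto intro!: derivative_eq_intros simp: field_simps)
    also have "(1 / x * arctan (x * y) + ln x * (y / (1 + (x * y)\<^sup>2))) / y - arctan (x * y) / x / y = ln x / (1 + x\<^sup>2 * y\<^sup>2)"
      using assms by (simp add: add_divide_distrib power_mult_distrib)
    finally show "(F has_real_derivative ln x / (1 + x\<^sup>2 * y\<^sup>2)) (at x)" .
  qed
  then show ?thesis by (simp add: F_def)
qed

text \<open>Two integrations by parts lead from arctan through \<open>Ti 2\<close> to
  \<open>Ti 3\<close>; only the term \<open>2 * Ti 3 1\<close> survives at the boundary.\<close>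

lemma has_integral_ln_sqr_div: "((\<lambda>x. (ln x)\<^sup>2 / (1 + x\<^sup>2)) has_integral pi ^ 3 / 16) {0..1}"
proof -
  define F where "F = (\<lambda>x. (ln x)\<^sup>2 * arctan x - 2 * (ln x * Ti 2 x) + 2 * Ti 3 x)"
  have "((\<lambda>x. (ln x)\<^sup>2 / (1 + x\<^sup>2)) has_integral F 1 - F 0) {0..1}"
  proof (rule has_integral_FTC_unit)
    have "continuous_on {0..1} (\<lambda>x::real. (ln x)\<^sup>2 * arctan x)"
    proof (rule continuous_on_unit_intervalI)
      show "((\<lambda>x::real. (ln x)\<^sup>2 * arctan x) \<longlongrightarrow> (ln 0)\<^sup>2 * arctan 0) (at_right 0)"
        by simp real_asymp
    qed (auto intro!: continuous_intros)
    moreover have "continuous_on {0..1} (\<lambda>x. ln x * Ti 2 x)"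
      using tendsto_ln_mult_Ti_2 [of 1]
      by (intro continuous_on_unit_intervalI)
         (auto intro!: continuous_intros continuous_on_subset [OF continuous_on_Ti])
    ultimately show "continuous_on {0..1} F"
      unfolding F_def by (intro continuous_on_diff continuous_on_add continuous_on_mult_left continuous_on_Ti) auto
    fix x :: real assume x: "0 < x" "x < 1"
    note [derivative_intros] = has_field_derivative_Ti_2 [OF x] has_field_derivative_Ti_3 [OF x]
    show "(F has_real_derivative (ln x)\<^sup>2 / (1 + x\<^sup>2)) (at x)"
      unfolding F_def using x
      by (auto intro!: derivative_eq_intros simp: field_simps add_nonneg_eq_0_iff)
  qed
  then show ?thesis by (simp add: F_def Ti_3_1)
qed

section \<open>The Fubini argument\<close>

text \<open>The grouping \<open>x * (x * ln x)\<close> lets the continuity of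
  \<open>x * ln x\<close> on the closed interval carry over to the kernel, including
  \<open>x = 0\<close>.\<close>

definition kern :: "real \<Rightarrow> real \<Rightarrow> real" where
  "kern x y = x * (x * ln x) / ((1 + x\<^sup>2) * (1 + x\<^sup>2 * y\<^sup>2))"

definition kern_integral :: "real \<Rightarrow> real" where
  "kern_integral y = integral {0..1} (\<lambda>x. kern x y)"

lemma continuous_on_mult_ln: "continuous_on {0..1} (\<lambda>x::real. x * ln x)"
proof (rule continuous_on_unit_intervalI)
  show "((\<lambda>x::real. x * ln x) \<longlongrightarrow> 0 * ln 0) (at_right 0)" by simp real_asymp
qed (auto intro!: continuous_intros)

lemma one_plus_nonneg_neq_0: "0 \<le> a \<Longrightarrow> 1 + a \<noteq> (0::real)"
  by linarith

lemma continuous_on_kern: "continuous_on ({0..1} \<times> {0..1}) (\<lambda>(x, y). kern x y)"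
proof -
  have "continuous_on ({0..1} \<times> {0..1}) (\<lambda>p::real\<times>real. fst p * ln (fst p))"
    by (rule continuous_on_compose2 [OF continuous_on_mult_ln]) (auto intro!: continuous_intros)
  then have "continuous_on ({0..1} \<times> {0..1})
      (\<lambda>p::real\<times>real. fst p * (fst p * ln (fst p)) / ((1 + (fst p)\<^sup>2) * (1 + (fst p)\<^sup>2 * (snd p)\<^sup>2)))"
    by (rule continuous_on_divide [OF continuous_on_mult [OF continuous_on_fst [OF continuous_on_id]]])
       (auto intro!: continuous_intros simp: one_plus_nonneg_neq_0)
  then show ?thesis by (simp add: kern_def split_def)
qed

lemma continuous_on_kern_integral: "continuous_on {0..1} kern_integral"
proof -
  have "continuous_on ({0..1} \<times> cbox 0 1) (\<lambda>(y, x). kern x y)"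
    using continuous_on_compose2 [OF continuous_on_kern, of "{0..1} \<times> {0..1}" prod.swap]
    by (force simp: split_def prod.swap_def intro!: continuous_intros)
  from integral_continuous_on_param [OF this] show ?thesis
    by (simp add: kern_integral_def [abs_def])
qed

text \<open>Fubini for a continuous integrand on the unit square. The weights used later, 1 and
  \<open>2 * y\<close>, are those for which the inner integral over \<open>y\<close> is
  elementary.\<close>

lemma integral_kern_swap:
  assumes w: "continuous_on {0..1} w"
  shows "((\<lambda>y. w y * kern_integral y) has_integral integral {0..1} (\<lambda>x. integral {0..1} (\<lambda>y. w y * kern x y))) {0..1}"
proof -
  have "continuous_on ({0..1} \<times> {0..1}) (\<lambda>p::real\<times>real. w (snd p) * kern (fst p) (snd p))"
    using continuous_on_kern
    by (intro continuous_on_mult continuous_on_compose2 [OF w]) (auto simp: split_def intro!: continuous_intros)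
  then have "continuous_on (cbox (0,0) (1,1)) (\<lambda>(x, y). w y * kern x y)"
    by (simp add: split_def cbox_Pair_eq)
  from integral_swap_continuous [OF this]
  have "integral {0..1} (\<lambda>x. integral {0..1} (\<lambda>y. w y * kern x y)) = integral {0..1} (\<lambda>y. w y * kern_integral y)"
    by (simp add: kern_integral_def)
  moreover have "(\<lambda>y. w y * kern_integral y) integrable_on {0..1}"
    by (intro integrable_continuous_real continuous_on_mult w continuous_on_kern_integral)
  ultimately show ?thesis by (simp add: has_integral_integral)
qed

lemma one_minus_square_factored: "1 - y\<^sup>2 = (1 - y) * (1 + y)" for y :: real
  by (simp add: algebra_simps power2_eq_square)

text \<open>Partial fractions: \<open>x^2 (1 - y^2) / ((1 + x^2) (1 + x^2 y^2))\<close> equals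
  \<open>1 / (1 + x^2 y^2) - 1 / (1 + x^2)\<close>, and both pieces times \<open>ln x\<close> are
  instances of \<open>has_integral_ln_div\<close>.\<close>

lemma kern_integral_eq:
  assumes "0 < y" "y < 1"
  shows "kern_integral y = (y * catalan_constant - Ti 2 y) / (y * (1 - y\<^sup>2))"
proof -
  have y: "1 - y\<^sup>2 \<noteq> 0" using assms by (simp add: power2_eq_1_iff)
  have "((\<lambda>x. (ln x / (1 + x\<^sup>2 * y\<^sup>2) - ln x / (1 + x\<^sup>2 * 1\<^sup>2)) / (1 - y\<^sup>2)) has_integral
          (- (Ti 2 y / y) - - (Ti 2 1 / 1)) / (1 - y\<^sup>2)) {0..1}"
    by (intro has_integral_divide has_integral_diff has_integral_ln_div) (use assms in auto)
  moreover have "(ln x / (1 + x\<^sup>2 * y\<^sup>2) - ln x / (1 + x\<^sup>2 * 1\<^sup>2)) / (1 - y\<^sup>2) = kern x y" for x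
  proof -
    have "1 + x\<^sup>2 \<noteq> 0" "1 + x\<^sup>2 * y\<^sup>2 \<noteq> 0" by (simp_all add: one_plus_nonneg_neq_0)
    then have "ln x / (1 + x\<^sup>2 * y\<^sup>2) - ln x / (1 + x\<^sup>2 * 1\<^sup>2) = kern x y * (1 - y\<^sup>2)"
      by (simp add: kern_def divide_simps) (simp add: algebra_simps power2_eq_square)
    then show ?thesis using y by simp
  qed
  ultimately have "((\<lambda>x. kern x y) has_integral (- (Ti 2 y / y) - - (Ti 2 1 / 1)) / (1 - y\<^sup>2)) {0..1}"
    by simp
  then have "kern_integral y = (- (Ti 2 y / y) - - (Ti 2 1 / 1)) / (1 - y\<^sup>2)"
    unfolding kern_integral_def by (rule integral_unique)
  also have "\<dots> = (y * catalan_constant - Ti 2 y) / (y * (1 - y\<^sup>2))"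
    using assms y by (simp add: Ti_2_1 divide_simps)
  finally show ?thesis .
qed

text \<open>Weight 1: integrating \<open>x / (1 + x^2 y^2)\<close> over \<open>y\<close> produces
  \<open>arctan x\<close>.\<close>

lemma has_integral_kern_integral:
  "(kern_integral has_integral integral {0..1} (\<lambda>x. x * arctan x * ln x / (1 + x\<^sup>2))) {0..1}"
proof -
  have *: "x * ln x / (1 + x\<^sup>2) * (x / (1 + x\<^sup>2 * y\<^sup>2)) = 1 * kern x y" for x y
    by (simp add: kern_def)
  have **: "((\<lambda>y. arctan (x * y)) has_real_derivative x / (1 + x\<^sup>2 * y\<^sup>2)) (at y)" for x y :: real
    by (auto intro!: derivative_eq_intros simp: power_mult_distrib inverse_eq_divide)
  have "((\<lambda>y. 1 * kern x y) has_integral x * ln x / (1 + x\<^sup>2) * arctan (x * 1) - x * ln x / (1 + x\<^sup>2) * arctan (x * 0)) {0..1}" for x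
  proof (rule has_integral_FTC_unit)
    show "((\<lambda>y. x * ln x / (1 + x\<^sup>2) * arctan (x * y)) has_real_derivative 1 * kern x y) (at y)" for y
      using DERIV_cmult [OF **, of "x * ln x / (1 + x\<^sup>2)" x y] unfolding * .
  qed (auto intro!: continuous_intros simp: one_plus_nonneg_neq_0)
  then have "integral {0..1} (\<lambda>y. 1 * kern x y) = x * arctan x * ln x / (1 + x\<^sup>2)" for x
    by (simp add: integral_unique mult_ac)
  then show ?thesis
    using integral_kern_swap [of "\<lambda>_. 1"] by simp
qed

text \<open>Weight \<open>2 * y\<close>: integrating \<open>2 x^2 y / (1 + x^2 y^2)\<close> over
  \<open>y\<close> produces \<open>ln (1 + x^2)\<close>.\<close>

lemma has_integral_mult_kern_integral:
  "((\<lambda>y. 2 * y * kern_integral y) has_integral integral {0..1} (\<lambda>x. ln x * ln (1 + x\<^sup>2) / (1 + x\<^sup>2))) {0..1}"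
proof -
  have *: "ln x / (1 + x\<^sup>2) * (2 * x\<^sup>2 * y / (1 + x\<^sup>2 * y\<^sup>2)) = 2 * y * kern x y" for x y
    by (simp add: kern_def power2_eq_square)
  have **: "((\<lambda>y. ln (1 + x\<^sup>2 * y\<^sup>2)) has_real_derivative 2 * x\<^sup>2 * y / (1 + x\<^sup>2 * y\<^sup>2)) (at y)" for x y :: real
    by (auto intro!: derivative_eq_intros simp: add_pos_nonneg)
  have "((\<lambda>y. 2 * y * kern x y) has_integral ln x / (1 + x\<^sup>2) * ln (1 + x\<^sup>2 * 1\<^sup>2) - ln x / (1 + x\<^sup>2) * ln (1 + x\<^sup>2 * 0\<^sup>2)) {0..1}" for x
  proof (rule has_integral_FTC_unit)
    show "((\<lambda>y. ln x / (1 + x\<^sup>2) * ln (1 + x\<^sup>2 * y\<^sup>2)) has_real_derivative 2 * y * kern x y) (at y)" for y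
      using DERIV_cmult [OF **, of "ln x / (1 + x\<^sup>2)" x y] unfolding * .
  qed (auto intro!: continuous_intros simp: one_plus_nonneg_neq_0)
  then have "integral {0..1} (\<lambda>y. 2 * y * kern x y) = ln x * ln (1 + x\<^sup>2) / (1 + x\<^sup>2)" for x
    by (simp add: integral_unique mult.commute)
  then show ?thesis
    using integral_kern_swap [of "\<lambda>y. 2 * y"] by (simp add: continuous_intros)
qed

section \<open>Integrating the closed form of the kernel integral by parts\<close>

lemma tendsto_ln_mult_catalan_diff:
  "((\<lambda>y. ln (1 - y) * (catalan_constant - Ti 2 y)) \<longlongrightarrow> 0) (at_left 1)"
proof (rule Lim_null_comparison)
  show "((\<lambda>y::real. (1 - y) * \<bar>ln (1 - y)\<bar>) \<longlongrightarrow> 0) (at_left 1)" by real_asymp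
  show "\<forall>\<^sub>F y in at_left 1. norm (ln (1 - y) * (catalan_constant - Ti 2 y)) \<le> (1 - y) * \<bar>ln (1 - y)\<bar>"
  proof (rule eventually_mono [OF eventually_at_left_real [of 0 1]])
    fix y :: real assume "y \<in> {0<..<1}"
    \<comment> \<open>Catalan's constant is \<open>Ti 2 1\<close>, so this is the Lipschitz bound
      between \<open>y\<close> and 1.\<close>
    then have "\<bar>catalan_constant - Ti 2 y\<bar> \<le> 1 - y"
      using Ti_2_diff_bounds [of y 1] by (simp add: Ti_2_1)
    then have "\<bar>ln (1 - y)\<bar> * \<bar>catalan_constant - Ti 2 y\<bar> \<le> \<bar>ln (1 - y)\<bar> * (1 - y)"
      by (intro mult_left_mono) auto
    then show "norm (ln (1 - y) * (catalan_constant - Ti 2 y)) \<le> (1 - y) * \<bar>ln (1 - y)\<bar>"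
      by (simp add: abs_mult mult.commute)
  qed simp
qed

text \<open>Here the singular endpoint is 1, where the value \<open>ln 0 * 0 = 0\<close> agrees with
  the limit just found.\<close>

lemma continuous_on_ln_mult_catalan_diff:
  "continuous_on {0..1} (\<lambda>y. ln (1 - y) * (catalan_constant - Ti 2 y))"
proof (rule continuous_on_IccI)
  have c: "continuous_on {0..1/2} (\<lambda>y. ln (1 - y) * (catalan_constant - Ti 2 y))"
    by (intro continuous_intros continuous_on_subset [OF continuous_on_Ti]) auto
  show "((\<lambda>y. ln (1 - y) * (catalan_constant - Ti 2 y)) \<longlongrightarrow> ln (1 - 0) * (catalan_constant - Ti 2 0)) (at_right 0)"
    using continuous_on_Icc_at_rightD [OF c] by simp
  show "((\<lambda>y. ln (1 - y) * (catalan_constant - Ti 2 y)) \<longlongrightarrow> ln (1 - 1) * (catalan_constant - Ti 2 1)) (at_left 1)"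
    using tendsto_ln_mult_catalan_diff by simp
  have "continuous_on {0<..<1} (\<lambda>y. ln (1 - y) * (catalan_constant - Ti 2 y))"
    by (intro continuous_intros continuous_on_subset [OF continuous_on_Ti]) auto
  then show "(\<lambda>y. ln (1 - y) * (catalan_constant - Ti 2 y)) \<midarrow>x\<rightarrow> ln (1 - x) * (catalan_constant - Ti 2 x)"
    if "0 < x" "x < 1" for x
    using that by (simp add: continuous_on_eq_continuous_at isCont_def)
qed simp

lemma continuous_on_ln_mult_catalan_diff':
  "continuous_on {0..1} (\<lambda>y. ln (1 + y) * (catalan_constant - Ti 2 y))"
  by (intro continuous_intros continuous_on_Ti) auto

text \<open>Building blocks for the next two antiderivatives: differentiating \<open>Ti 2\<close>
  creates the integrands with \<open>ln (1 - y)\<close> and \<open>ln (1 + y)\<close>,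
  differentiating the logarithm creates partial fractions of the kernel integral.\<close>

lemma has_field_derivative_ln_mult_catalan_diff:
  assumes "0 < y" "y < 1"
  shows "((\<lambda>y. ln (1 - y) * (catalan_constant - Ti 2 y)) has_real_derivative
      - (catalan_constant - Ti 2 y) / (1 - y) - arctan y * ln (1 - y) / y) (at y)"
    and "((\<lambda>y. ln (1 + y) * (catalan_constant - Ti 2 y)) has_real_derivative
      (catalan_constant - Ti 2 y) / (1 + y) - arctan y * ln (1 + y) / y) (at y)"
    and "((\<lambda>y. catalan_constant * ln (1 + y)) has_real_derivative catalan_constant / (1 + y)) (at y)"
  using assms by (auto intro!: derivative_eq_intros has_field_derivative_Ti_2 simp: divide_simps) (simp add: algebra_simps)

text \<open>Stated for the whole sum because its antiderivative is explicit; integrability of the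
  summand with \<open>ln (1 - y)\<close>, which is unbounded near 1, is extracted from it
  later.\<close>

lemma has_integral_kern_integral_plus:
  "((\<lambda>y. kern_integral y + (arctan y * ln (1 + y) / y + arctan y * ln (1 - y) / y) / 2) has_integral
     catalan_constant * ln 2 - pi ^ 3 / 32) {0..1}"
proof -
  define F where "F = (\<lambda>y. catalan_constant * ln (1 + y) - Ti 3 y -
    (ln (1 - y) * (catalan_constant - Ti 2 y) + ln (1 + y) * (catalan_constant - Ti 2 y)) / 2)"
  have "((\<lambda>y. kern_integral y + (arctan y * ln (1 + y) / y + arctan y * ln (1 - y) / y) / 2) has_integral F 1 - F 0) {0..1}"
  proof (rule has_integral_FTC_unit)
    have "continuous_on {0..1} (\<lambda>y::real. catalan_constant * ln (1 + y))"
      by (auto intro!: continuous_intros)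
    then show "continuous_on {0..1} F"
      unfolding F_def
      by (intro continuous_on_diff continuous_on_divide continuous_on_add continuous_on_Ti
        continuous_on_ln_mult_catalan_diff continuous_on_ln_mult_catalan_diff' continuous_on_const) auto
    fix y :: real assume y: "0 < y" "y < 1"
    have "(F has_real_derivative catalan_constant / (1 + y) - Ti 2 y / y -
        ((- (catalan_constant - Ti 2 y) / (1 - y) - arctan y * ln (1 - y) / y) +
         ((catalan_constant - Ti 2 y) / (1 + y) - arctan y * ln (1 + y) / y)) / 2) (at y)"
      unfolding F_def
      by (intro DERIV_diff DERIV_add DERIV_cdivide has_field_derivative_ln_mult_catalan_diff
          has_field_derivative_Ti_3 y)
    \<comment> \<open>Partial fractions arranged so that every pole at \<open>y = 1\<close> carries
      the vanishing factor \<open>catalan_constant - Ti 2 y\<close>.\<close>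
    moreover have "catalan_constant / (1 + y) - Ti 2 y / y -
        (- (catalan_constant - Ti 2 y) / (1 - y) + (catalan_constant - Ti 2 y) / (1 + y)) / 2 = kern_integral y"
      unfolding kern_integral_eq [OF y] one_minus_square_factored
      using y by (simp add: divide_simps) (simp add: algebra_simps)
    ultimately show "(F has_real_derivative kern_integral y + (arctan y * ln (1 + y) / y + arctan y * ln (1 - y) / y) / 2) (at y)"
      by (auto simp: diff_divide_distrib add_divide_distrib algebra_simps elim!: back_subst [where P = "\<lambda>d. (F has_real_derivative d) (at y)"])
  qed
  then show ?thesis by (simp add: F_def Ti_2_1 Ti_3_1)
qed

text \<open>The weight \<open>2 * y\<close> cancels the pole at 0, so \<open>Ti 3\<close> does not
  enter; the value is the boundary term of \<open>2 * catalan_constant * ln (1 + y)\<close>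
  alone.\<close>

lemma has_integral_mult_kern_integral_minus:
  "((\<lambda>y. 2 * y * kern_integral y - arctan y * ln (1 + y) / y + arctan y * ln (1 - y) / y) has_integral
     - (2 * catalan_constant * ln 2)) {0..1}"
proof -
  define F where "F = (\<lambda>y. ln (1 + y) * (catalan_constant - Ti 2 y) -
    ln (1 - y) * (catalan_constant - Ti 2 y) - 2 * (catalan_constant * ln (1 + y)))"
  have "((\<lambda>y. 2 * y * kern_integral y - arctan y * ln (1 + y) / y + arctan y * ln (1 - y) / y) has_integral F 1 - F 0) {0..1}"
  proof (rule has_integral_FTC_unit)
    have "continuous_on {0..1} (\<lambda>y::real. 2 * (catalan_constant * ln (1 + y)))"
      by (auto intro!: continuous_intros)
    then show "continuous_on {0..1} F"
      unfolding F_def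
      by (intro continuous_on_diff
        continuous_on_ln_mult_catalan_diff continuous_on_ln_mult_catalan_diff') auto
    fix y :: real assume y: "0 < y" "y < 1"
    have "(F has_real_derivative ((catalan_constant - Ti 2 y) / (1 + y) - arctan y * ln (1 + y) / y) -
        (- (catalan_constant - Ti 2 y) / (1 - y) - arctan y * ln (1 - y) / y)
        - 2 * (catalan_constant / (1 + y))) (at y)"
      unfolding F_def
      by (intro DERIV_diff DERIV_cmult has_field_derivative_ln_mult_catalan_diff y)
    moreover have "(catalan_constant - Ti 2 y) / (1 + y) + (catalan_constant - Ti 2 y) / (1 - y)
        - 2 * (catalan_constant / (1 + y)) = 2 * y * kern_integral y"
      unfolding kern_integral_eq [OF y] one_minus_square_factored
      using y by (simp add: divide_simps) (simp add: algebra_simps)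
    ultimately show "(F has_real_derivative 2 * y * kern_integral y - arctan y * ln (1 + y) / y + arctan y * ln (1 - y) / y) (at y)"
      by (auto simp: diff_divide_distrib algebra_simps elim!: back_subst [where P = "\<lambda>d. (F has_real_derivative d) (at y)"])
  qed
  then show ?thesis by (simp add: F_def Ti_2_1 mult.assoc)
qed

section \<open>The duplication argument\<close>

text \<open>Substitution \<open>t = arctan x\<close>, \<open>dt = dx / (1 + x^2)\<close>. Absolute
  integrability is the setting of the change-of-variables theorem and admits integrands that are
  unbounded at 0.\<close>

lemma has_integral_tan_subst:
  fixes f :: "real \<Rightarrow> real"
  assumes "(\<lambda>x. f x / (1 + x\<^sup>2)) absolutely_integrable_on {0..1}"
  shows "((\<lambda>t. f (tan t)) has_integral integral {0..1} (\<lambda>x. f x / (1 + x\<^sup>2))) {0..pi/4}"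
proof -
  have "inj_on arctan {0..1}" by (simp add: inj_on_def arctan_eq_iff)
  moreover have "(arctan has_real_derivative inverse (1 + x\<^sup>2)) (at x within {0..1})" for x
    by (auto intro!: derivative_eq_intros)
  \<comment> \<open>With \<open>b\<close> arbitrary, instantiating it by the integral itself later
    yields integrability and the value together.\<close>
  ultimately have iff: "(\<lambda>x. \<bar>inverse (1 + x\<^sup>2)\<bar> * f (tan (arctan x))) absolutely_integrable_on {0..1} \<and>
      integral {0..1} (\<lambda>x. \<bar>inverse (1 + x\<^sup>2)\<bar> * f (tan (arctan x))) = b
     \<longleftrightarrow> (\<lambda>t. f (tan t)) absolutely_integrable_on (arctan ` {0..1}) \<and> integral (arctan ` {0..1}) (\<lambda>t. f (tan t)) = b" for b
    by (intro has_absolute_integral_change_of_variables_1') auto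
  have eq: "\<bar>inverse (1 + x\<^sup>2)\<bar> * f (tan (arctan x)) = f x / (1 + x\<^sup>2)" for x
    by (simp add: tan_arctan divide_inverse add_nonneg_nonneg mult.commute)
  have image: "arctan ` {0..1} = {0..pi/4}"
  proof (intro equalityI subsetI)
    fix t assume t: "t \<in> {0..pi/4}"
    then have t': "- (pi/2) < t" "t < pi/2" "t \<le> pi/4" "0 \<le> t"
      using pi_gt_zero unfolding atLeastAtMost_iff by linarith+
    then have "arctan (tan t) = t" by (intro arctan_tan)
    moreover have "tan t \<le> tan (pi/4)" using t' by (intro tan_mono_le) auto
    moreover have "0 \<le> tan t" using t' by (intro tan_pos_pi2_le)
    ultimately show "t \<in> arctan ` {0..1}"
      by (intro image_eqI [of _ _ "tan t"]) (auto simp: tan_45)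
  next
    fix t assume "t \<in> arctan ` {0..1}"
    then obtain x where "t = arctan x" "0 \<le> x" "x \<le> 1" by auto
    moreover from this have "arctan x \<le> arctan 1" by (simp only: arctan_le_iff)
    ultimately show "t \<in> {0..pi/4}" by (simp add: arctan_one)
  qed
  note iffD1 [OF iff [unfolded eq image], OF conjI [OF assms refl]]
  then have "(\<lambda>t. f (tan t)) integrable_on {0..pi/4}"
    and "integral {0..pi/4} (\<lambda>t. f (tan t)) = integral {0..1} (\<lambda>x. f x / (1 + x\<^sup>2))"
    by (blast intro: set_lebesgue_integral_eq_integral(1))+
  then show ?thesis by (simp add: has_integral_iff)
qed

lemma ln_sin_cos_tan:
  assumes "0 < t" "t < pi / 2"
  shows "ln (cos t) = - (ln (1 + (tan t)\<^sup>2) / 2)"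
    and "ln (sin t) = ln (tan t) - ln (1 + (tan t)\<^sup>2) / 2"
    and "ln (sin (2 * t)) = ln 2 + ln (tan t) - ln (1 + (tan t)\<^sup>2)"
proof -
  have c: "cos t > 0" "sin t > 0" using assms by (auto intro: cos_gt_zero_pi sin_gt_zero)
  have "1 + (tan t)\<^sup>2 = inverse ((cos t)\<^sup>2)"
    using c tan_sec [of t] by (simp add: power_inverse)
  then have "ln (1 + (tan t)\<^sup>2) = - (2 * ln (cos t))"
    using c by (simp add: ln_inverse ln_realpow)
  then show 1: "ln (cos t) = - (ln (1 + (tan t)\<^sup>2) / 2)" by simp
  have "ln (tan t) = ln (sin t) - ln (cos t)"
    using c by (simp add: tan_def ln_div)
  then show 2: "ln (sin t) = ln (tan t) - ln (1 + (tan t)\<^sup>2) / 2" using 1 by simp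
  show "ln (sin (2 * t)) = ln 2 + ln (tan t) - ln (1 + (tan t)\<^sup>2)"
    using c 1 2 by (simp add: sin_double ln_mult)
qed

text \<open>The duplication \<open>sin (2 t) = 2 sin t cos t\<close>, written in the variable \<open>x = tan t\<close>.\<close>
lemma integral_duplication:
  fixes f :: "real \<Rightarrow> real"
  assumes s: "(\<lambda>x. f (ln x - ln (1 + x\<^sup>2) / 2) / (1 + x\<^sup>2)) absolutely_integrable_on {0..1}"
    and c: "(\<lambda>x. f (- (ln (1 + x\<^sup>2) / 2)) / (1 + x\<^sup>2)) absolutely_integrable_on {0..1}"
    and d: "(\<lambda>x. f (ln 2 + ln x - ln (1 + x\<^sup>2)) / (1 + x\<^sup>2)) absolutely_integrable_on {0..1}"
  shows "2 * integral {0..1} (\<lambda>x. f (ln 2 + ln x - ln (1 + x\<^sup>2)) / (1 + x\<^sup>2)) =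
    integral {0..1} (\<lambda>x. f (ln x - ln (1 + x\<^sup>2) / 2) / (1 + x\<^sup>2)) +
    integral {0..1} (\<lambda>x. f (- (ln (1 + x\<^sup>2) / 2)) / (1 + x\<^sup>2))"
    (is "2 * ?D = ?S + ?C")
proof -
  \<comment> \<open>The identities between \<open>sin\<close>, \<open>cos\<close> and
    \<open>tan\<close> need \<open>t > 0\<close>; changing the integrand at the single point 0 is
    harmless.\<close>
  have spike: "(g has_integral I) {0..pi/4}"
    if "(h has_integral I) {0..pi/4}" "\<And>t. 0 < t \<Longrightarrow> t < pi / 2 \<Longrightarrow> g t = h t" for g h :: "real \<Rightarrow> real" and I
    by (rule has_integral_spike_finite [of "{0}" _ _ h]) (use that in auto)
  have S: "((\<lambda>t. f (ln (sin t))) has_integral ?S) {0..pi/4}"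
    by (rule spike [OF has_integral_tan_subst [OF s]]) (simp add: ln_sin_cos_tan)
  have D: "((\<lambda>t. f (ln (sin (2 * t)))) has_integral ?D) {0..pi/4}"
    by (rule spike [OF has_integral_tan_subst [OF d]]) (simp add: ln_sin_cos_tan)
  have "((\<lambda>t. f (ln (cos t))) has_integral ?C) {0..pi/4}"
    by (rule spike [OF has_integral_tan_subst [OF c]]) (simp add: ln_sin_cos_tan)
  \<comment> \<open>Reflection \<open>t \<mapsto> - t\<close> followed by a shift by
    \<open>pi/2\<close> turns the cosine integral over \<open>[0, pi/4]\<close> into the sine
    integral over \<open>[pi/4, pi/2]\<close>.\<close>
  then have "((\<lambda>t. f (ln (cos (- t)))) has_integral ?C) {- (pi/4)..- 0}"
    by (subst has_integral_reflect_real)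
  then have "((\<lambda>t. f (ln (cos t))) has_integral ?C) (cbox (- (pi/4)) 0)"
    by simp
  moreover have "cos (1 *\<^sub>R t + - (pi/2)) = sin t" for t by (simp add: cos_diff)
  moreover have "(- (pi/4) - - (pi/2)) /\<^sub>R 1 = pi/4" "(0 - - (pi/2)) /\<^sub>R 1 = pi/2" by (simp_all add: field_simps)
  ultimately have "((\<lambda>t. f (ln (sin t))) has_integral ?C) {pi/4..pi/2}"
    using has_integral_affinity' [of "\<lambda>t. f (ln (cos t))" ?C "- (pi/4)" 0 1 "- (pi/2)"] by simp
  \<comment> \<open>The two pieces make up the sine integral over \<open>[0, pi/2]\<close>;
    rescaling by 2 halves it and gives the integral of \<open>f (ln (sin (2 * t)))\<close> over
    \<open>[0, pi/4]\<close>.\<close>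
  with S have "((\<lambda>t. f (ln (sin t))) has_integral ?S + ?C) {0..pi/2}"
    by (rule has_integral_combine [rotated 2]) auto
  then have "((\<lambda>t. f (ln (sin t))) has_integral ?S + ?C) (cbox 0 (pi/2))" by simp
  from has_integral_affinity' [OF this, of 2 0]
  have "((\<lambda>t. f (ln (sin (2 * t)))) has_integral (?S + ?C) / 2) {0..pi/4}"
    by (simp add: field_simps)
  with D have "?D = (?S + ?C) / 2" by (rule has_integral_unique)
  then show ?thesis by simp
qed

section \<open>Applying duplication to the identity and the square\<close>

lemma nonpositive_absolutely_integrable:
  fixes f :: "real \<Rightarrow> real"
  assumes "f integrable_on A" "\<And>x. x \<in> A \<Longrightarrow> f x \<le> 0"
  shows "f absolutely_integrable_on A"
proof -
  have "(\<lambda>x. - f x) absolutely_integrable_on A"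
    by (rule nonnegative_absolutely_integrable_1) (use assms in \<open>auto intro: integrable_neg\<close>)
  then have "(\<lambda>x. - 1 *\<^sub>R (- f x)) absolutely_integrable_on A"
    by (rule absolutely_integrable_scaleR_left)
  then show ?thesis by simp
qed

lemma has_integral_ln_div_one_plus_square: "((\<lambda>x. ln x / (1 + x\<^sup>2)) has_integral - catalan_constant) {0..1}"
  using has_integral_ln_div [of 1] by (simp add: Ti_2_1)

lemma absolutely_integrable_ln_div: "(\<lambda>x::real. ln x / (1 + x\<^sup>2)) absolutely_integrable_on {0..1}"
proof (rule nonpositive_absolutely_integrable)
  show "(\<lambda>x::real. ln x / (1 + x\<^sup>2)) integrable_on {0..1}"
    using has_integral_ln_div_one_plus_square by (rule has_integral_integrable)
  show "ln x / (1 + x\<^sup>2) \<le> 0" if "x \<in> {0..1}" for x :: real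
    using that by (cases "x = 0") (auto intro!: divide_nonpos_nonneg)
qed

lemma absolutely_integrable_ln_sqr_div: "(\<lambda>x::real. (ln x)\<^sup>2 / (1 + x\<^sup>2)) absolutely_integrable_on {0..1}"
  by (rule nonnegative_absolutely_integrable_1)
     (use has_integral_ln_sqr_div in \<open>auto simp: has_integral_integrable\<close>)

lemma continuous_on_ln_ln_div: "continuous_on {0..1} (\<lambda>x::real. ln x * ln (1 + x\<^sup>2) / (1 + x\<^sup>2))"
proof (rule continuous_on_unit_intervalI)
  show "((\<lambda>x::real. ln x * ln (1 + x\<^sup>2) / (1 + x\<^sup>2)) \<longlongrightarrow> ln 0 * ln (1 + 0\<^sup>2) / (1 + 0\<^sup>2)) (at_right 0)"
    by simp real_asymp
qed (auto intro!: continuous_intros simp: one_plus_nonneg_neq_0)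

lemma continuous_on_ln_one_plus_div:
  "continuous_on {0..1} (\<lambda>x::real. ln (1 + x\<^sup>2) / (1 + x\<^sup>2))"
  "continuous_on {0..1} (\<lambda>x::real. (ln (1 + x\<^sup>2))\<^sup>2 / (1 + x\<^sup>2))"
  "continuous_on {0..1} (\<lambda>x::real. 1 / (1 + x\<^sup>2))"
  by (auto intro!: continuous_intros simp: one_plus_nonneg_neq_0)

lemmas absolutely_integrable_continuous_quotients =
  continuous_on_ln_ln_div [THEN absolutely_integrable_continuous_real]
  continuous_on_ln_one_plus_div [THEN absolutely_integrable_continuous_real]

lemma has_integral_one_div: "((\<lambda>x::real. 1 / (1 + x\<^sup>2)) has_integral pi / 4) {0..1}"
proof -
  have "((\<lambda>x::real. 1 / (1 + x\<^sup>2)) has_integral arctan 1 - arctan 0) {0..1}"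
    by (rule has_integral_FTC_unit) (auto intro!: continuous_intros derivative_eq_intros simp: divide_inverse)
  then show ?thesis by (simp add: arctan_one)
qed

text \<open>Duplication with \<open>f = id\<close>: the unknown integral has coefficient -2 on the
  left and -1 on the right, so the equation determines it.\<close>

lemma has_integral_ln_one_plus_div:
  "((\<lambda>x::real. ln (1 + x\<^sup>2) / (1 + x\<^sup>2)) has_integral pi / 2 * ln 2 - catalan_constant) {0..1}"
proof -
  define N where "N = integral {0..1} (\<lambda>x::real. ln (1 + x\<^sup>2) / (1 + x\<^sup>2))"
  have N: "((\<lambda>x::real. ln (1 + x\<^sup>2) / (1 + x\<^sup>2)) has_integral N) {0..1}"
    unfolding N_def by (intro integrable_integral set_lebesgue_integral_eq_integral(1) absolutely_integrable_continuous_quotients)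
  have s: "(\<lambda>x::real. (ln x - ln (1 + x\<^sup>2) / 2) / (1 + x\<^sup>2)) = (\<lambda>x. ln x / (1 + x\<^sup>2) - 1/2 * (ln (1 + x\<^sup>2) / (1 + x\<^sup>2)))"
    and c: "(\<lambda>x::real. (- (ln (1 + x\<^sup>2) / 2)) / (1 + x\<^sup>2)) = (\<lambda>x. - 1/2 * (ln (1 + x\<^sup>2) / (1 + x\<^sup>2)))"
    and d: "(\<lambda>x::real. (ln 2 + ln x - ln (1 + x\<^sup>2)) / (1 + x\<^sup>2)) =
       (\<lambda>x. ln 2 * (1 / (1 + x\<^sup>2)) + ln x / (1 + x\<^sup>2) - ln (1 + x\<^sup>2) / (1 + x\<^sup>2))"
    by (simp_all add: diff_divide_distrib add_divide_distrib)
  note int = has_integral_one_div has_integral_ln_div_one_plus_square N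
  have "2 * integral {0..1} (\<lambda>x::real. id (ln 2 + ln x - ln (1 + x\<^sup>2)) / (1 + x\<^sup>2)) =
    integral {0..1} (\<lambda>x::real. id (ln x - ln (1 + x\<^sup>2) / 2) / (1 + x\<^sup>2)) +
    integral {0..1} (\<lambda>x::real. id (- (ln (1 + x\<^sup>2) / 2)) / (1 + x\<^sup>2))"
    by (rule integral_duplication; unfold id_def s c d)
       (intro set_integral_add set_integral_diff set_integrable_mult_right absolutely_integrable_continuous_quotients absolutely_integrable_ln_div)+
  moreover have "integral {0..1} (\<lambda>x::real. id (ln 2 + ln x - ln (1 + x\<^sup>2)) / (1 + x\<^sup>2)) = ln 2 * (pi / 4) + (- catalan_constant) - N"
    unfolding id_def d by (intro integral_unique has_integral_add has_integral_diff has_integral_mult_right int)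
  moreover have "integral {0..1} (\<lambda>x::real. id (ln x - ln (1 + x\<^sup>2) / 2) / (1 + x\<^sup>2)) = - catalan_constant - 1/2 * N"
    unfolding id_def s by (intro integral_unique has_integral_add has_integral_diff has_integral_mult_right int)
  moreover have "integral {0..1} (\<lambda>x::real. id (- (ln (1 + x\<^sup>2) / 2)) / (1 + x\<^sup>2)) = - 1/2 * N"
    unfolding id_def c by (intro integral_unique has_integral_add has_integral_diff has_integral_mult_right int)
  ultimately have "2 * (ln 2 * (pi / 4) + (- catalan_constant) - N) = (- catalan_constant - 1/2 * N) + (- 1/2 * N)"
    by (simp only:)
  then have "N = pi / 2 * ln 2 - catalan_constant" by (simp add: field_simps)
  then show ?thesis using N by simp
qed

text \<open>Duplication with \<open>f\<close> the square. After expansion the terms with Catalan's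
  constant cancel, and what remains is one linear relation between \<open>E\<close> and
  \<open>Z\<close>.\<close>

lemma integral_ln_ln_div_eq:
  fixes E Z :: real
  assumes E: "((\<lambda>x. ln x * ln (1 + x\<^sup>2) / (1 + x\<^sup>2)) has_integral E) {0..1}"
    and Z: "((\<lambda>x. (ln (1 + x\<^sup>2))\<^sup>2 / (1 + x\<^sup>2)) has_integral Z) {0..1}"
  shows "E = Z / 2 - pi / 2 * (ln 2)\<^sup>2 + pi ^ 3 / 48"
proof -
  have s': "(a - b / 2)\<^sup>2 / q = a\<^sup>2 / q - a * b / q + 1/4 * (b\<^sup>2 / q)" for a b q :: real
    by (cases "q = 0") (simp_all add: power2_eq_square field_simps)
  have d': "(l + a - b)\<^sup>2 / q = l\<^sup>2 * (1 / q) + a\<^sup>2 / q + b\<^sup>2 / q + 2 * l * (a / q) - 2 * l * (b / q) - 2 * (a * b / q)"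
    for a b l q :: real
    by (cases "q = 0") (simp_all add: power2_eq_square field_simps)
  have s: "(\<lambda>x::real. (ln x - ln (1 + x\<^sup>2) / 2)\<^sup>2 / (1 + x\<^sup>2)) =
      (\<lambda>x. (ln x)\<^sup>2 / (1 + x\<^sup>2) - ln x * ln (1 + x\<^sup>2) / (1 + x\<^sup>2) + 1/4 * ((ln (1 + x\<^sup>2))\<^sup>2 / (1 + x\<^sup>2)))"
    and c: "(\<lambda>x::real. (- (ln (1 + x\<^sup>2) / 2))\<^sup>2 / (1 + x\<^sup>2)) = (\<lambda>x. 1/4 * ((ln (1 + x\<^sup>2))\<^sup>2 / (1 + x\<^sup>2)))"
    and d: "(\<lambda>x::real. (ln 2 + ln x - ln (1 + x\<^sup>2))\<^sup>2 / (1 + x\<^sup>2)) =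
       (\<lambda>x. (ln 2)\<^sup>2 * (1 / (1 + x\<^sup>2)) + (ln x)\<^sup>2 / (1 + x\<^sup>2) + (ln (1 + x\<^sup>2))\<^sup>2 / (1 + x\<^sup>2)
         + 2 * ln 2 * (ln x / (1 + x\<^sup>2)) - 2 * ln 2 * (ln (1 + x\<^sup>2) / (1 + x\<^sup>2)) - 2 * (ln x * ln (1 + x\<^sup>2) / (1 + x\<^sup>2)))"
    by (intro ext s' d', simp add: power_divide, intro ext d')
  note int = has_integral_one_div has_integral_ln_div_one_plus_square has_integral_ln_one_plus_div has_integral_ln_sqr_div E Z
  let ?f = "\<lambda>x::real. x\<^sup>2"
  have "2 * integral {0..1} (\<lambda>x::real. ?f (ln 2 + ln x - ln (1 + x\<^sup>2)) / (1 + x\<^sup>2)) =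
    integral {0..1} (\<lambda>x::real. ?f (ln x - ln (1 + x\<^sup>2) / 2) / (1 + x\<^sup>2)) +
    integral {0..1} (\<lambda>x::real. ?f (- (ln (1 + x\<^sup>2) / 2)) / (1 + x\<^sup>2))"
    by (rule integral_duplication; unfold s c d)
       (intro set_integral_add set_integral_diff set_integrable_mult_right absolutely_integrable_continuous_quotients absolutely_integrable_ln_div absolutely_integrable_ln_sqr_div)+
  moreover have "integral {0..1} (\<lambda>x::real. ?f (ln 2 + ln x - ln (1 + x\<^sup>2)) / (1 + x\<^sup>2)) =
      (ln 2)\<^sup>2 * (pi / 4) + pi ^ 3 / 16 + Z + 2 * ln 2 * (- catalan_constant) - 2 * ln 2 * (pi / 2 * ln 2 - catalan_constant) - 2 * E"
    unfolding d by (intro integral_unique has_integral_add has_integral_diff has_integral_mult_right int)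
  moreover have "integral {0..1} (\<lambda>x::real. ?f (ln x - ln (1 + x\<^sup>2) / 2) / (1 + x\<^sup>2)) = pi ^ 3 / 16 - E + 1/4 * Z"
    unfolding s by (intro integral_unique has_integral_add has_integral_diff has_integral_mult_right int)
  moreover have "integral {0..1} (\<lambda>x::real. ?f (- (ln (1 + x\<^sup>2) / 2)) / (1 + x\<^sup>2)) = 1/4 * Z"
    unfolding c by (intro integral_unique has_integral_add has_integral_diff has_integral_mult_right int)
  ultimately have "2 * ((ln 2)\<^sup>2 * (pi / 4) + pi ^ 3 / 16 + Z + 2 * ln 2 * (- catalan_constant) - 2 * ln 2 * (pi / 2 * ln 2 - catalan_constant) - 2 * E)
      = (pi ^ 3 / 16 - E + 1/4 * Z) + 1/4 * Z"
    by (simp only:)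
  then show ?thesis by (simp add: field_simps power2_eq_square)
qed

section \<open>The contour argument\<close>

text \<open>On this convex half-plane \<open>1 + z\<close> avoids the branch cut and the singularity
  at 0 is removable. A primitive there replaces the closed contour integral by endpoint
  values.\<close>

lemma ex_primitive_Ln_sqr_div:
  obtains H where "\<And>z. Re z > -1 \<Longrightarrow> (H has_field_derivative (Ln (1 + z))\<^sup>2 / z) (at z)"
proof -
  define S where "S = {z. Re z > -1}"
  have S: "open S" "convex S"
    unfolding S_def by (auto simp: open_halfspace_Re_gt convex_halfspace_Re_gt)
  have nz: "1 + z \<notin> \<real>\<^sub>\<le>\<^sub>0" if "z \<in> S" for z
    using that by (auto simp: S_def complex_nonpos_Reals_iff)
  have "(\<lambda>z. (Ln (1 + z))\<^sup>2 / z) holomorphic_on S"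
  proof (rule no_isolated_singularity' [where K = "{0}"])
    show "(\<lambda>z. (Ln (1 + z))\<^sup>2 / z) holomorphic_on S - {0}"
      using nz by (intro holomorphic_intros) auto
    fix z :: complex assume "z \<in> {0}"
    have "((\<lambda>z. Ln (1 + z)) has_field_derivative 1) (at 0)"
      by (auto intro!: derivative_eq_intros)
    then have "((\<lambda>z. Ln (1 + z) / z) \<longlongrightarrow> 1) (at 0)"
      by (simp add: has_field_derivative_iff)
    moreover have "((\<lambda>z. Ln (1 + z)) \<longlongrightarrow> 0) (at 0)"
      by (rule tendsto_eq_intros refl | simp)+
    ultimately have "((\<lambda>z. Ln (1 + z) / z * Ln (1 + z)) \<longlongrightarrow> 1 * 0) (at 0)"
      by (rule tendsto_mult)
    \<comment> \<open>The value at 0 is 0 by the convention for division by zero, which is also the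
      limit, so the function needs no redefinition.\<close>
    then have "((\<lambda>z. (Ln (1 + z))\<^sup>2 / z) \<longlongrightarrow> (Ln (1 + 0))\<^sup>2 / 0) (at 0)"
      by (simp add: power2_eq_square)
    then show "((\<lambda>z. (Ln (1 + z))\<^sup>2 / z) \<longlongrightarrow> (Ln (1 + z))\<^sup>2 / z) (at z within S)"
      using \<open>z \<in> {0}\<close> by (auto intro: tendsto_within_subset)
  qed (use S in auto)
  then show ?thesis
  proof (rule holomorphic_convex_primitive' [OF S(2,1)])
    fix H assume H: "\<And>z. z \<in> S \<Longrightarrow> (H has_field_derivative (Ln (1 + z))\<^sup>2 / z) (at z within S)"
    show ?thesis
    proof (rule that)
      fix z assume "Re z > -1"
      then have "z \<in> S" by (simp add: S_def)
      from H [OF this] show "(H has_field_derivative (Ln (1 + z))\<^sup>2 / z) (at z)"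
        unfolding at_within_open [OF \<open>z \<in> S\<close> S(1)] .
    qed
  qed
qed

text \<open>In the right half-plane \<open>Ln z\<close> has real part \<open>ln (norm z)\<close> and
  imaginary part \<open>arctan (Im z / Re z)\<close>; squaring gives both formulas.\<close>

lemma Im_Re_Ln_sqr:
  assumes "Re z > 0"
  shows "Im ((Ln z)\<^sup>2) = 2 * ln (norm z) * arctan (Im z / Re z)"
    and "Re ((Ln z)\<^sup>2) = (ln (norm z))\<^sup>2 - (arctan (Im z / Re z))\<^sup>2"
proof -
  have "z \<noteq> 0" using assms by auto
  then have "Re (Ln z) = ln (norm z)" "Im (Ln z) = arctan (Im z / Re z)"
    using assms by (simp_all add: arg_conv_arctan flip: Arg_eq_Im_Ln)
  then show "Im ((Ln z)\<^sup>2) = 2 * ln (norm z) * arctan (Im z / Re z)"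
    and "Re ((Ln z)\<^sup>2) = (ln (norm z))\<^sup>2 - (arctan (Im z / Re z))\<^sup>2"
    by (simp_all add: power2_eq_square)
qed

text \<open>Chain rule along a real curve, so that each side of the contour is handled by the real
  fundamental theorem.\<close>

lemma has_real_derivative_Im:
  assumes "(f has_field_derivative D) (at (g x))" "(g has_vector_derivative g') (at x)"
  shows "((\<lambda>x. Im (f (g x))) has_real_derivative Im (D * g')) (at x)"
proof -
  have "((f \<circ> g) has_vector_derivative g' * D) (at x)"
    using field_vector_diff_chain_at [OF assms(2,1)] .
  then have "((\<lambda>x. Im ((f \<circ> g) x)) has_vector_derivative Im (g' * D)) (at x)"
    by (rule bounded_linear.has_vector_derivative [OF bounded_linear_Im])
  then show ?thesis
    by (simp add: has_real_derivative_iff_has_vector_derivative o_def mult.commute)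
qed

text \<open>Cauchy's theorem for \<open>Ln (1 + z)\<^sup>2 / z\<close> on the quarter disc, with the arc
  parametrised by \<open>z = (1 + \<i> x) / (1 - \<i> x)\<close>, so that \<open>1 + z = 2 / (1 - \<i> x)\<close> and
  \<open>dz / z = 2 \<i> dx / (1 + x\<^sup>2)\<close>.\<close>
lemma has_integral_arctan_ln_contour:
  fixes I :: real
  assumes I: "((\<lambda>x. 2 / (1 + x\<^sup>2) * ((ln 2 - ln (1 + x\<^sup>2) / 2)\<^sup>2 - (arctan x)\<^sup>2)) has_integral I) {0..1}"
  shows "((\<lambda>x. arctan x * ln (1 + x\<^sup>2) / x) has_integral I) {0..1}"
proof -
  obtain H where H: "\<And>z. Re z > -1 \<Longrightarrow> (H has_field_derivative (Ln (1 + z))\<^sup>2 / z) (at z)"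
    using ex_primitive_Ln_sqr_div by blast
  have FTC: "(f has_integral F 1 - F 0) {0..1}"
    if "\<And>x. 0 \<le> x \<Longrightarrow> x \<le> 1 \<Longrightarrow> (F has_real_derivative f x) (at x)" for f F :: "real \<Rightarrow> real"
    by (rule has_integral_FTC_unit) (use that in \<open>auto intro!: DERIV_atLeastAtMost_imp_continuous_on\<close>)
  have norm: "ln (norm (Complex 1 y)) = ln (1 + y\<^sup>2) / 2" for y
    by (simp add: complex_norm ln_sqrt add_pos_nonneg)
  \<comment> \<open>First side, the segment from 0 to 1: the integrand is real there, so
    \<open>Im H\<close> has the same value at both ends.\<close>
  have "((\<lambda>x::real. 0) has_integral Im (H (of_real 1)) - Im (H (of_real 0))) {0..1}"
  proof (rule FTC [where F = "\<lambda>x. Im (H (of_real x))"])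
    fix x :: real assume x: "0 \<le> x" "x \<le> 1"
    have "((\<lambda>x. of_real x) has_vector_derivative (1 :: complex)) (at x)"
      by (auto intro!: derivative_eq_intros)
    from has_real_derivative_Im [OF H this] x
    have "((\<lambda>x. Im (H (of_real x))) has_real_derivative Im ((Ln (1 + of_real x))\<^sup>2 / of_real x * 1)) (at x)"
      by simp
    moreover have "Im ((Ln (1 + of_real x))\<^sup>2 / of_real x * 1) = 0"
      using x Im_Re_Ln_sqr(1) [of "1 + of_real x"] by simp
    ultimately show "((\<lambda>x. Im (H (of_real x))) has_real_derivative 0) (at x)" by metis
  qed
  then have H1: "Im (H 1) = Im (H 0)"
    using has_integral_0_eq by force
  \<comment> \<open>Second side, the segment from 0 to \<open>\<i>\<close>: the factor
    \<open>\<i>\<close> from \<open>dz\<close> cancels against \<open>z = \<i> x\<close>.\<close>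
  have "((\<lambda>x. arctan x * ln (1 + x\<^sup>2) / x) has_integral Im (H (\<i> * of_real 1)) - Im (H (\<i> * of_real 0))) {0..1}"
  proof (rule FTC [where F = "\<lambda>x. Im (H (\<i> * of_real x))"])
    fix x :: real assume x: "0 \<le> x" "x \<le> 1"
    have "((\<lambda>x. \<i> * of_real x) has_vector_derivative \<i>) (at x)"
      by (auto intro!: derivative_eq_intros)
    from has_real_derivative_Im [OF H this] x
    have "((\<lambda>x. Im (H (\<i> * of_real x))) has_real_derivative Im ((Ln (1 + \<i> * of_real x))\<^sup>2 / (\<i> * of_real x) * \<i>)) (at x)"
      by simp
    \<comment> \<open>At \<open>x = 0\<close> both sides are 0 by the convention for division by
      zero.\<close>
    moreover have "Im ((Ln (1 + \<i> * of_real x))\<^sup>2 / (\<i> * of_real x) * \<i>) = arctan x * ln (1 + x\<^sup>2) / x"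
    proof -
      have "1 + \<i> * of_real x = Complex 1 x" by (simp add: complex_eq_iff)
      then have "Im ((Ln (1 + \<i> * of_real x))\<^sup>2) = arctan x * ln (1 + x\<^sup>2)"
        using Im_Re_Ln_sqr(1) [of "Complex 1 x"] by (simp add: norm)
      moreover have "(Ln (1 + \<i> * of_real x))\<^sup>2 / (\<i> * of_real x) * \<i> = (Ln (1 + \<i> * of_real x))\<^sup>2 / of_real x"
        by (simp add: divide_simps)
      ultimately show ?thesis by (simp add: Im_divide_of_real)
    qed
    ultimately show "((\<lambda>x. Im (H (\<i> * of_real x))) has_real_derivative arctan x * ln (1 + x\<^sup>2) / x) (at x)" by metis
  qed
  then have C: "((\<lambda>x. arctan x * ln (1 + x\<^sup>2) / x) has_integral Im (H \<i>) - Im (H 0)) {0..1}" by simp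
  define g where "g = (\<lambda>x. (1 + \<i> * of_real x) / (1 - \<i> * of_real x))"
  \<comment> \<open>Third side, the arc from \<open>g 0 = 1\<close> to
    \<open>g 1 = \<i>\<close>.\<close>
  have "((\<lambda>x. 2 / (1 + x\<^sup>2) * ((ln 2 - ln (1 + x\<^sup>2) / 2)\<^sup>2 - (arctan x)\<^sup>2)) has_integral Im (H (g 1)) - Im (H (g 0))) {0..1}"
  proof (rule FTC [where F = "\<lambda>x. Im (H (g x))"])
    fix x :: real assume x: "0 \<le> x" "x \<le> 1"
    have nz: "1 - \<i> * of_real x \<noteq> 0" "1 + \<i> * of_real x \<noteq> 0" by (auto simp: complex_eq_iff)
    have sq: "(1 - \<i> * of_real x) * (1 + \<i> * of_real x) = of_real (1 + x\<^sup>2)"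
      by (simp add: complex_eq_iff power2_eq_square)
    have pos: "1 + x\<^sup>2 > 0" by (simp add: add_pos_nonneg)
    \<comment> \<open>This exhibits \<open>1 + g x\<close> as a positive multiple of
      \<open>1 + \<i> x\<close>: its argument is \<open>arctan x\<close>, and its positive real part
      keeps the arc inside the domain of \<open>H\<close>.\<close>
    have g1: "1 + g x = of_real (2 / (1 + x\<^sup>2)) * Complex 1 x"
    proof -
      have "1 + g x = 2 * (1 + \<i> * of_real x) / ((1 - \<i> * of_real x) * (1 + \<i> * of_real x))"
      proof -
        have "1 + (1 + w) / (1 - w) = 2 * (1 + w) / ((1 - w) * (1 + w))"
          if "1 - w \<noteq> 0" "1 + w \<noteq> 0" for w :: complex
          using that by (simp add: divide_simps)
        from this [OF nz] show ?thesis unfolding g_def .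
      qed
      then show ?thesis unfolding sq by (simp add: complex_eq_iff Re_divide_of_real Im_divide_of_real)
    qed
    have "Re (1 + g x) > 0" unfolding g1 using pos by simp
    then have "Re (g x) > -1" by simp
    have dg: "(g has_vector_derivative 2 * \<i> / (1 - \<i> * of_real x)\<^sup>2) (at x)"
    proof -
      have "((\<lambda>z. (1 + \<i> * z) / (1 - \<i> * z)) has_field_derivative 2 * \<i> / (1 - \<i> * of_real x)\<^sup>2) (at (of_real x))"
        using nz by (auto intro!: derivative_eq_intros simp: field_simps power2_eq_square)
      then show ?thesis
        unfolding g_def by (rule has_vector_derivative_real_field)
    qed
    have "(Ln (1 + g x))\<^sup>2 / ((1 + \<i> * of_real x) / (1 - \<i> * of_real x)) * (2 * \<i> / (1 - \<i> * of_real x)\<^sup>2) = \<i> * of_real (2 / (1 + x\<^sup>2)) * (Ln (1 + g x))\<^sup>2"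
    proof -
      have "L\<^sup>2 / (p / m) * (2 * \<i> / m\<^sup>2) = 2 * \<i> * L\<^sup>2 / (m * p)"
        if "p \<noteq> 0" "m \<noteq> 0" for p m L :: complex
        using that by (simp add: divide_simps power2_eq_square)
      from this [OF nz(2,1), of "Ln (1 + g x)"] show ?thesis
        unfolding sq by simp
    qed
    then have e: "(Ln (1 + g x))\<^sup>2 / g x * (2 * \<i> / (1 - \<i> * of_real x)\<^sup>2) = \<i> * of_real (2 / (1 + x\<^sup>2)) * (Ln (1 + g x))\<^sup>2"
      by (simp only: g_def)
    have "ln (norm (1 + g x)) = ln 2 - ln (1 + x\<^sup>2) / 2"
    proof -
      have "norm (1 + g x) = 2 / (1 + x\<^sup>2) * norm (Complex 1 x)"
        unfolding g1 norm_mult norm_of_real using pos by simp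
      moreover have "norm (Complex 1 x) > 0" by (simp add: complex_eq_iff)
      ultimately have "ln (norm (1 + g x)) = ln (2 / (1 + x\<^sup>2)) + ln (norm (Complex 1 x))"
        using pos by (simp only: ln_mult_pos zero_less_divide_iff zero_less_numeral simp_thms)
      then show ?thesis using pos by (simp add: norm ln_div)
    qed
    moreover have "Im (1 + g x) / Re (1 + g x) = x"
      unfolding g1 using pos by simp
    ultimately have D: "Im ((Ln (1 + g x))\<^sup>2 / g x * (2 * \<i> / (1 - \<i> * of_real x)\<^sup>2))
        = 2 / (1 + x\<^sup>2) * ((ln 2 - ln (1 + x\<^sup>2) / 2)\<^sup>2 - (arctan x)\<^sup>2)"
      unfolding e using Im_Re_Ln_sqr(2) [OF \<open>Re (1 + g x) > 0\<close>] by simp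
    show "((\<lambda>x. Im (H (g x))) has_real_derivative 2 / (1 + x\<^sup>2) * ((ln 2 - ln (1 + x\<^sup>2) / 2)\<^sup>2 - (arctan x)\<^sup>2)) (at x)"
      using has_real_derivative_Im [OF H [OF \<open>Re (g x) > -1\<close>] dg] unfolding D .
  qed
  moreover have "g 0 = 1" "g 1 = \<i>" by (auto simp: g_def complex_eq_iff Re_divide Im_divide)
  ultimately have "I = Im (H \<i>) - Im (H 0)"
    using has_integral_unique [OF I] H1 by simp
  then show ?thesis using C by simp
qed

section \<open>The ten identities\<close>

theorem mainTheorem13:
  shows
    "((\<lambda>x::real. x * arctan x * ln x / (1 + x\<^sup>2)) integrable_on {0..1}) \<and>
     ((\<lambda>x::real. arctan x * ln (1 + x) / x) integrable_on {0..1}) \<and>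
     ((\<lambda>x::real. arctan x * ln (1 + x\<^sup>2) / x) integrable_on {0..1}) \<and>
     ((\<lambda>x::real. arctan x * ln (1 - x) / x) integrable_on {0..1}) \<and>
     ((\<lambda>x::real. ln x * ln (1 + x\<^sup>2) / (1 + x\<^sup>2)) integrable_on {0..1}) \<and>
     ((\<lambda>x::real. x * arctan x * ln (1 + x\<^sup>2) / (1 + x\<^sup>2)) integrable_on {0..1}) \<and>
     6 * integral {0..1} (\<lambda>x::real. x * arctan x * ln x / (1 + x\<^sup>2))
        + 4 * integral {0..1} (\<lambda>x::real. arctan x * ln (1 + x) / x)
        = - (3 * pi ^ 3 / 32) + 6 * catalan_constant * ln 2 \<and>
     integral {0..1} (\<lambda>x::real. x * arctan x * ln x / (1 + x\<^sup>2))
        + integral {0..1} (\<lambda>x::real. arctan x * ln (1 + x\<^sup>2) / x)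
        = - (pi ^ 3 / 64) + catalan_constant * ln 2 \<and>
     integral {0..1} (\<lambda>x::real. x * arctan x * ln x / (1 + x\<^sup>2))
        + 2 * integral {0..1} (\<lambda>x::real. arctan x * ln (1 - x) / x)
        = - (5 * pi ^ 3 / 64) + catalan_constant * ln 2 \<and>
     3 * integral {0..1} (\<lambda>x::real. ln x * ln (1 + x\<^sup>2) / (1 + x\<^sup>2))
        - 2 * integral {0..1} (\<lambda>x::real. arctan x * ln (1 + x) / x)
        = - (6 * catalan_constant * ln 2) + 3 * pi ^ 3 / 32 \<and>
     integral {0..1} (\<lambda>x::real. ln x * ln (1 + x\<^sup>2) / (1 + x\<^sup>2))
        - integral {0..1} (\<lambda>x::real. arctan x * ln (1 + x\<^sup>2) / x)
        = - (2 * catalan_constant * ln 2) + pi ^ 3 / 32 \<and>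
     integral {0..1} (\<lambda>x::real. ln x * ln (1 + x\<^sup>2) / (1 + x\<^sup>2))
        - 2 * integral {0..1} (\<lambda>x::real. arctan x * ln (1 - x) / x)
        = - (2 * catalan_constant * ln 2) + 3 * pi ^ 3 / 32 \<and>
     integral {0..1} (\<lambda>x::real. arctan x * ln (1 + x) / x)
        + 3 * integral {0..1} (\<lambda>x::real. x * arctan x * ln (1 + x\<^sup>2) / (1 + x\<^sup>2))
        = 3 * catalan_constant * ln 2 - pi ^ 3 / 64 - 9 * pi / 16 * (ln 2)\<^sup>2 \<and>
     integral {0..1} (\<lambda>x::real. arctan x * ln (1 - x) / x)
        + integral {0..1} (\<lambda>x::real. x * arctan x * ln (1 + x\<^sup>2) / (1 + x\<^sup>2))
        = catalan_constant * ln 2 - 7 * pi ^ 3 / 192 - 3 * pi / 16 * (ln 2)\<^sup>2 \<and>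
     integral {0..1} (\<lambda>x::real. ln x * ln (1 + x\<^sup>2) / (1 + x\<^sup>2))
        + integral {0..1} (\<lambda>x::real. x * arctan x * ln x / (1 + x\<^sup>2))
        = - (catalan_constant * ln 2) + pi ^ 3 / 64 \<and>
     2 * integral {0..1} (\<lambda>x::real. x * arctan x * ln (1 + x\<^sup>2) / (1 + x\<^sup>2))
        - integral {0..1} (\<lambda>x::real. x * arctan x * ln x / (1 + x\<^sup>2))
        = catalan_constant * ln 2 + pi ^ 3 / 192 - 3 * pi / 8 * (ln 2)\<^sup>2"
proof -
  let ?a = "\<lambda>x::real. x * arctan x * ln x / (1 + x\<^sup>2)"
  let ?b = "\<lambda>x::real. arctan x * ln (1 + x) / x"
  let ?c = "\<lambda>x::real. arctan x * ln (1 + x\<^sup>2) / x"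
  let ?d = "\<lambda>x::real. arctan x * ln (1 - x) / x"
  let ?e = "\<lambda>x::real. ln x * ln (1 + x\<^sup>2) / (1 + x\<^sup>2)"
  let ?f = "\<lambda>x::real. x * arctan x * ln (1 + x\<^sup>2) / (1 + x\<^sup>2)"
  let ?z = "\<lambda>x::real. (ln (1 + x\<^sup>2))\<^sup>2 / (1 + x\<^sup>2)"
  let ?L = "ln 2 :: real" and ?G = catalan_constant
  define A B C D E F Z where "A = integral {0..1} ?a" "B = integral {0..1} ?b"
    "C = integral {0..1} ?c" "D = integral {0..1} ?d" "E = integral {0..1} ?e"
    "F = integral {0..1} ?f" "Z = integral {0..1} ?z"
  note defs = this
  have pos: "1 + x\<^sup>2 > 0" for x :: real by (simp add: add_pos_nonneg)
  have "continuous_on {0..1} (\<lambda>x::real. arctan x / (1 + x\<^sup>2) * (x * ln x))"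
    by (intro continuous_on_mult continuous_on_mult_ln) (auto intro!: continuous_intros simp: one_plus_nonneg_neq_0)
  then have a: "?a integrable_on {0..1}"
    by (intro integrable_continuous_real) (simp add: mult_ac)
  have b: "?b integrable_on {0..1}"
  proof (intro integrable_continuous_real continuous_on_unit_intervalI)
    show "(?b \<longlongrightarrow> ?b 0) (at_right 0)" by simp real_asymp
  qed (auto intro!: continuous_intros)
  have c: "?c integrable_on {0..1}"
  proof (intro integrable_continuous_real continuous_on_unit_intervalI)
    show "(?c \<longlongrightarrow> ?c 0) (at_right 0)" by simp real_asymp
  qed (auto intro!: continuous_intros simp: one_plus_nonneg_neq_0)
  have e: "?e integrable_on {0..1}"
    by (intro integrable_continuous_real continuous_on_ln_ln_div)
  have f: "?f integrable_on {0..1}"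
    by (intro integrable_continuous_real) (auto intro!: continuous_intros simp: one_plus_nonneg_neq_0)
  have z: "?z integrable_on {0..1}"
    by (intro integrable_continuous_real continuous_on_ln_one_plus_div)
  have I: "(?a has_integral A) {0..1}" "(?b has_integral B) {0..1}" "(?c has_integral C) {0..1}"
    "(?e has_integral E) {0..1}" "(?f has_integral F) {0..1}" "(?z has_integral Z) {0..1}"
    unfolding defs by (intro integrable_integral a b c e f z)+

  have intK: "(kern_integral has_integral A) {0..1}" and mulK: "((\<lambda>y. 2 * y * kern_integral y) has_integral E) {0..1}"
    unfolding defs by (rule has_integral_kern_integral has_integral_mult_kern_integral)+
  \<comment> \<open>The integrand \<open>?d\<close> is unbounded near 1, so its integrability does
    not come from continuity; it is recovered by subtracting integrable pieces from the explicit
    sum.\<close>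
  have "((\<lambda>y. 2 * ((kern_integral y + (?b y + ?d y) / 2) - kern_integral y) - ?b y) has_integral
      2 * ((?G * ?L - pi ^ 3 / 32) - A) - B) {0..1}"
    by (intro has_integral_diff has_integral_mult_right has_integral_kern_integral_plus intK I)
  moreover have "2 * ((k + (b + d) / 2) - k) - b = d" for k b d :: real by (simp add: field_simps)
  ultimately have d: "(?d has_integral 2 * ((?G * ?L - pi ^ 3 / 32) - A) - B) {0..1}"
    by (simp only:)
  then have D: "D = 2 * ((?G * ?L - pi ^ 3 / 32) - A) - B" and Id: "(?d has_integral D) {0..1}"
    unfolding defs by (auto simp: integral_unique)
  have "((\<lambda>y. 2 * y * kern_integral y - ?b y + ?d y) has_integral E - B + D) {0..1}"
    by (intro has_integral_diff has_integral_add mulK I Id)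
  with has_integral_mult_kern_integral_minus have EBD: "E - B + D = - (2 * ?G * ?L)"
    using has_integral_unique by blast

  \<comment> \<open>The product rule yields the integrands of \<open>E\<close>, \<open>C\<close> and
    \<open>2 * A\<close>; both boundary values vanish, at 1 because \<open>ln 1 = 0\<close>.\<close>
  define P where "P = (\<lambda>x::real. arctan x * (ln x * ln (1 + x\<^sup>2)))"
  have "((\<lambda>x. ?e x + ?c x + 2 * ?a x) has_integral P 1 - P 0) {0..1}"
  proof (rule has_integral_FTC_unit)
    show "continuous_on {0..1} P"
    proof (rule continuous_on_unit_intervalI)
      show "(P \<longlongrightarrow> P 0) (at_right 0)" unfolding P_def by simp real_asymp
    qed (auto simp: P_def one_plus_nonneg_neq_0 intro!: continuous_intros)
    show "(P has_real_derivative ?e x + ?c x + 2 * ?a x) (at x)" if "0 < x" "x < 1" for x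
      unfolding P_def using that pos [of x]
      by (auto intro!: derivative_eq_intros simp: divide_simps) (simp add: algebra_simps power2_eq_square)
  qed
  moreover have "((\<lambda>x. ?e x + ?c x + 2 * ?a x) has_integral E + C + 2 * A) {0..1}"
    by (intro has_integral_add has_integral_mult_right I)
  ultimately have "E + C + 2 * A = P 1 - P 0" by (rule has_integral_unique [rotated])
  then have ECA: "E + C + 2 * A = 0" by (simp add: P_def)

  \<comment> \<open>Chosen so that its derivative combines the integrands of \<open>Z\<close> and
    \<open>4 * F\<close>; its value at 1 is \<open>pi / 4 * (ln 2)^2\<close>.\<close>
  define Q where "Q = (\<lambda>x::real. arctan x * (ln (1 + x\<^sup>2))\<^sup>2)"
  have "((\<lambda>x. ?z x + 4 * ?f x) has_integral Q 1 - Q 0) {0..1}"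
  proof (rule has_integral_FTC_unit)
    show "continuous_on {0..1} Q"
      unfolding Q_def by (auto simp: one_plus_nonneg_neq_0 intro!: continuous_intros)
    show "(Q has_real_derivative ?z x + 4 * ?f x) (at x)" if "0 < x" "x < 1" for x
      unfolding Q_def using that pos [of x]
      by (auto intro!: derivative_eq_intros simp: divide_simps)
  qed
  moreover have "((\<lambda>x. ?z x + 4 * ?f x) has_integral Z + 4 * F) {0..1}"
    by (intro has_integral_add has_integral_mult_right I)
  ultimately have "Z + 4 * F = Q 1 - Q 0" by (rule has_integral_unique [rotated])
  then have ZF: "Z + 4 * F = pi / 4 * ?L\<^sup>2"
    by (simp add: Q_def arctan_one)

  define R where "R = (\<lambda>x::real. arctan x ^ 3 / 3)"
  have "((\<lambda>x. (arctan x)\<^sup>2 / (1 + x\<^sup>2)) has_integral R 1 - R 0) {0..1}"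
  proof (rule has_integral_FTC_unit)
    show "(R has_real_derivative (arctan x)\<^sup>2 / (1 + x\<^sup>2)) (at x)" for x
      unfolding R_def using pos [of x]
      by (auto intro!: derivative_eq_intros simp: divide_simps)
  qed (auto simp: R_def intro!: continuous_intros)
  then have R: "((\<lambda>x. (arctan x)\<^sup>2 / (1 + x\<^sup>2)) has_integral pi ^ 3 / 192) {0..1}"
    by (simp add: R_def arctan_one power_divide)
  \<comment> \<open>Expands the arc integrand into four pieces: two with integrals already
    evaluated, one giving \<open>Z\<close>, and one with \<open>R\<close> as primitive.\<close>
  have t: "2 * l\<^sup>2 * (1 / q) - 2 * l * (b / q) + 1/2 * (b\<^sup>2 / q) - 2 * (a\<^sup>2 / q) = 2 / q * ((l - b / 2)\<^sup>2 - a\<^sup>2)"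
    for a b l q :: real
    by (cases "q = 0") (simp_all add: power2_eq_square field_simps)
  have "((\<lambda>x::real. 2 * ?L\<^sup>2 * (1 / (1 + x\<^sup>2)) - 2 * ?L * (ln (1 + x\<^sup>2) / (1 + x\<^sup>2)) + 1/2 * ?z x - 2 * ((arctan x)\<^sup>2 / (1 + x\<^sup>2)))
     has_integral 2 * ?L\<^sup>2 * (pi / 4) - 2 * ?L * (pi / 2 * ?L - ?G) + 1/2 * Z - 2 * (pi ^ 3 / 192)) {0..1}"
    by (intro has_integral_add has_integral_diff has_integral_mult_right has_integral_one_div
        has_integral_ln_one_plus_div I R)
  also have "(\<lambda>x::real. 2 * ?L\<^sup>2 * (1 / (1 + x\<^sup>2)) - 2 * ?L * (ln (1 + x\<^sup>2) / (1 + x\<^sup>2)) + 1/2 * ?z x - 2 * ((arctan x)\<^sup>2 / (1 + x\<^sup>2)))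
     = (\<lambda>x. 2 / (1 + x\<^sup>2) * ((ln 2 - ln (1 + x\<^sup>2) / 2)\<^sup>2 - (arctan x)\<^sup>2))"
    by (intro ext t)
  finally have "C = 2 * ?L\<^sup>2 * (pi / 4) - 2 * ?L * (pi / 2 * ?L - ?G) + 1/2 * Z - 2 * (pi ^ 3 / 192)"
    using I(3) has_integral_arctan_ln_contour has_integral_unique by blast
  then have CZ: "C = 2 * (?G * ?L) - pi / 2 * ?L\<^sup>2 + Z / 2 - pi ^ 3 / 96"
    by (simp add: algebra_simps power2_eq_square)
  have EZ: "E = Z / 2 - pi / 2 * ?L\<^sup>2 + pi ^ 3 / 48"
    by (rule integral_ln_ln_div_eq) (rule I)+
  \<comment> \<open>The collected relations express all six integrals through \<open>Z\<close>
    alone; each identity is a linear combination in which \<open>Z\<close> cancels.\<close>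
  show ?thesis
    unfolding defs [symmetric]
    using a b c e f Id D EBD ECA ZF CZ EZ
    by (intro conjI; (auto simp: has_integral_integrable)?; (simp add: field_simps; fail)?)
qed

end
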